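(* Let $k\ge 2$ be an integer. A set $K\subseteq\Omega$ is a $(\mathsf J,\mathsf{MU}^k_{01})$-clonoid if and only if it is one of the following classes: (a) $\mathsf U^k_\Theta$ for $\Theta\in\mathrm{Id}_k$; (b) $\mathsf U^k_\Theta\cap(\Omega_{01}\cup\mathsf C_0)$ and $\mathsf U^k_\Theta\cap\Omega_{01}$ for nonempty $\Theta\in\mathrm{Id}_k(\Omega_{*1})$; (c) $\mathsf U^k_\Theta\cap(\Omega_{10}\cup\mathsf C_0)$ and $\mathsf U^k_\Theta\cap\Omega_{10}$ for nonempty $\Theta\in\mathrm{Id}_k(\Omega_{1*})$; (d) $\mathsf U^k_\Theta\cap\mathsf M_{0*}$ and $\mathsf U^k_\Theta\cap\mathsf M_{01}$ for nonempty $\Theta\in\mathrm{Id}_k(\mathsf M)$; (e) $\mathsf U^k_\Theta\cap\overline{\mathsf M}_{*0}$ and $\mathsf U^k_\Theta\cap\overline{\mathsf M}_{10}$ for nonempty $\Theta\in\mathrm{Id}_k(\overline{\mathsf M})$; (f) $\mathsf U^k_\Theta\cap\mathsf R_{00}$ for nonempty $\Theta\in\mathrm{Id}_k(\mathsf R)$; (g) $\Omega_{\le}$, $\Omega_{\ge}$, $\Omega_{=}$, $\Omega_{0*}\cup\mathsf C$, $\Omega_{*0}\cup\mathsf C$, $\Omega_{1*}\cup\mathsf C$, $\Omega_{*1}\cup\mathsf C$, $\Omega_{00}\cup\mathsf C$, $\Omega_{01}\cup\mathsf C$, $\Omega_{10}\cup\mathsf C$, $\Omega_{11}\cup\mathsf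 C$, $\Omega_{01}\cup\mathsf C_1$, $\Omega_{10}\cup\mathsf C_1$, $\Omega_{1*}$, $\Omega_{*1}$, $\Omega_{11}$, $\mathsf M$, $\mathsf M_{*1}$, $\overline{\mathsf M}$, $\overline{\mathsf M}_{1*}$, $\mathsf R$, $\mathsf R_{00}\cup\mathsf C$, $\mathsf R_{11}\cup\mathsf C$, $\mathsf R_{11}$, $\mathsf C$, $\mathsf C_1$.
   Context: Boolean functions: maps $f:\{0,1\}^n\to\{0,1\}$ with $n\ge1$; $\Omega$ is the set of all of them. $\mathbf 0,\mathbf 1$ denote constant tuples, tuples are ordered componentwise, $\overline{\mathbf a}$ is the componentwise complement, $[n]=\{1,\dots,n\}$. Composition: for $f$ $n$-ary and $g_1,\dots,g_n$ $m$-ary, $f(g_1,\dots,g_n)(\mathbf a)=f(g_1(\mathbf a),\dots,g_n(\mathbf a))$. For $I,J\subseteq\Omega$, $IJ$ is the set of all $f(g_1,\dots,g_n)$ with $f\in I$ $n$-ary and $g_1,\dots,g_n\in J$ of a common arity. $\mathsf J$ is the set of all projections. For an integer $k\ge2$, $\mathsf{MU}^k_{01}$ is the clone of all monotone $f\in\Omega$ with $f(\mathbf 0)=0$, $f(\mathbf 1)=1$ such that $\bigwedge T\ne\mathbf 0$ for every $T\subseteq f^{-1}(1)$ with $|T|\le k$. A $(\mathsf J,\mathsf{MU}^k_{01})$-clonoid is a set $K\subseteq\Omega$ with $K\mathsf J\subseteq K$ and $\mathsf{MU}^k_{01}K\subseteq K$ ($K=\emptyset$ allowed). Classes: $\mathsf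 M$ = monotone functions; $\overline{\mathsf M}$ = negations $1-f$ of monotone $f$; $\mathsf R$ = reflexive functions ($f(\mathbf a)=f(\overline{\mathbf a})$ for all $\mathbf a$); $\mathsf C$ = constant functions, $\mathsf C_0$, $\mathsf C_1$ = constant $0$ (resp. $1$) functions (of all arities). For $X\subseteq\Omega$ and $a,b\in\{0,1\}$: $X_{a*}=\{f\in X: f(\mathbf 0)=a\}$, $X_{*b}=\{f\in X: f(\mathbf 1)=b\}$, $X_{ab}=X_{a*}\cap X_{*b}$. $\Omega_{=}$, $\Omega_{\le}$, $\Omega_{\ge}$ are the sets of $f$ with $f(\mathbf 0)=f(\mathbf 1)$, $f(\mathbf 0)\le f(\mathbf 1)$, $f(\mathbf 0)\ge f(\mathbf 1)$, respectively. Orders: for $g$ $m$-ary and $\sigma:[m]\to[n]$, let $g_\sigma(a_1,\dots,a_n)=g(a_{\sigma(1)},\dots,a_{\sigma(m)})$; the functions $g_\sigma$ are the minors of $g$. $f$ is a minorant of $g$ (same arity) if $f(\mathbf a)\le g(\mathbf a)$ for all $\mathbf a$. The quasiorder $\sqsubseteq$ on $\Omega$ is the transitive closure of the union of the relations "is a minorant of" and "is a minor of". For $X\subseteq\Omega$, $\downarrow X=\{f\in\Omega:\exists x\in X,\ f\sqsubseteq x\}$. For $\mathcal C\in\{\Omega_{*1},\Omega_{1*},\mathsf M,\overline{\mathsf M},\mathsf R\}$, $f^{\mathcal C}$ is the least majorant of $f$ (in the pointwise order, same arity) that lies in $\mathcal C$ (it exists). $\sqsubseteq_{\mathcal C}$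 is the transitive closure of the union of "is a minorant of", "is a minor of", and the relation $\{(f,g): f=g^{\mathcal C}\}$. $\Omega^{[\le k]}$ is the set of $f\in\Omega$ with $|f^{-1}(1)|\le k$. $\mathrm{Id}_k$ is the set of all $\Theta\subseteq\Omega^{[\le k]}$ that are downward closed with respect to $\sqsubseteq$ inside $\Omega^{[\le k]}$ (if $f\in\Omega^{[\le k]}$, $\theta\in\Theta$, $f\sqsubseteq\theta$, then $f\in\Theta$); $\mathrm{Id}_k(\mathcal C)$ is defined in the same way with $\sqsubseteq_{\mathcal C}$ in place of $\sqsubseteq$. The empty set is allowed in both. For $T\subseteq\{0,1\}^n$, $\chi_T$ is the $n$-ary function with $\chi_T^{-1}(1)=T$. For $\Theta\subseteq\Omega$, $\mathsf U^k_\Theta$ is the set of all $f\in\Omega$ such that $\chi_T\in\downarrow\Theta$ for every $T\subseteq f^{-1}(1)$ with $|T|\le k$. *)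

theory Defs
  imports Main "HOL-Library.FuncSet"
begin

text \<open>
  Truth values are \<^typ>\<open>bool\<close> (\<^term>\<open>False\<close> is 0, \<^term>\<open>True\<close> is 1, ordered by
  \<open>\<le>\<close>).  An \<open>n\<close>-tuple is a list of length \<open>n\<close>; its positions are \<open>0, \<dots>, n - 1\<close>
  instead of \<open>1, \<dots>, n\<close>.  A Boolean function is a pair of its arity \<open>n \<ge> 1\<close> and a map
  that is extensional on the \<open>n\<close>-tuples, so that equality of pairs is equality of
  functions of the same arity.
\<close>

type_synonym boolfun = "nat \<times> (bool list \<Rightarrow> bool)"

abbreviation arity :: "boolfun \<Rightarrow> nat" where "arity f \<equiv> fst f"

abbreviation val :: "boolfun \<Rightarrow> bool list \<Rightarrow> bool" where "val f \<equiv> snd f"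

definition tuples :: "nat \<Rightarrow> bool list set" where
  "tuples n = {a. length a = n}"

definition Omega :: "boolfun set" where
  "Omega = {f. 1 \<le> arity f \<and> val f \<in> tuples (arity f) \<rightarrow>\<^sub>E UNIV}"

definition mkfun :: "nat \<Rightarrow> (bool list \<Rightarrow> bool) \<Rightarrow> boolfun" where
  "mkfun n h = (n, restrict h (tuples n))"

definition tuple_le :: "bool list \<Rightarrow> bool list \<Rightarrow> bool" where
  "tuple_le a b \<longleftrightarrow> list_all2 (\<le>) a b"

definition at0 :: "boolfun \<Rightarrow> bool" where
  "at0 f = val f (replicate (arity f) False)"

definition at1 :: "boolfun \<Rightarrow> bool" where
  "at1 f = val f (replicate (arity f) True)"

definition ones :: "boolfun \<Rightarrow> bool list set" where
  "ones f = {a \<in> tuples (arity f). val f a}"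

definition chi :: "nat \<Rightarrow> bool list set \<Rightarrow> boolfun" where
  "chi n T = mkfun n (\<lambda>a. a \<in> T)"


subsection \<open>Composition and clonoids\<close>

definition compose_fun :: "boolfun \<Rightarrow> nat \<Rightarrow> boolfun list \<Rightarrow> boolfun" where
  "compose_fun f m gs = mkfun m (\<lambda>a. val f (map (\<lambda>g. val g a) gs))"

definition class_comp :: "boolfun set \<Rightarrow> boolfun set \<Rightarrow> boolfun set" where
  "class_comp I J = {compose_fun f m gs | f m gs.
     f \<in> I \<and> length gs = arity f \<and> (\<forall>g \<in> set gs. g \<in> J \<and> arity g = m)}"

definition Proj :: "boolfun set" where
  "Proj = {mkfun n (\<lambda>a. a ! i) | n i. i < n}"

definition Mon :: "boolfun set" where
  "Mon = {f \<in> Omega. \<forall>a \<in> tuples (arity f). \<forall>b \<in> tuples (arity f).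
            tuple_le a b \<longrightarrow> val f a \<le> val f b}"

text \<open>The componentwise meet of a set of \<open>n\<close>-tuples; the empty meet is the all-ones tuple.\<close>

definition meet :: "nat \<Rightarrow> bool list set \<Rightarrow> bool list" where
  "meet n T = map (\<lambda>i. \<forall>a \<in> T. a ! i) [0..<n]"

definition MU01 :: "nat \<Rightarrow> boolfun set" where
  "MU01 k = {f \<in> Mon. \<not> at0 f \<and> at1 f \<and>
     (\<forall>T. T \<subseteq> ones f \<and> card T \<le> k \<longrightarrow> meet (arity f) T \<noteq> replicate (arity f) False)}"

definition clonoid :: "boolfun set \<Rightarrow> boolfun set \<Rightarrow> boolfun set \<Rightarrow> bool" where
  "clonoid C1 C2 K \<longleftrightarrow> K \<subseteq> Omega \<and> class_comp K C1 \<subseteq> K \<and> class_comp C2 K \<subseteq> K"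


subsection \<open>Classes of functions\<close>

definition neg :: "boolfun \<Rightarrow> boolfun" where
  "neg f = mkfun (arity f) (\<lambda>a. \<not> val f a)"

definition Mon_bar :: "boolfun set" where
  "Mon_bar = neg ` Mon"

definition Reflexive :: "boolfun set" where
  "Reflexive = {f \<in> Omega. \<forall>a \<in> tuples (arity f). val f a = val f (map Not a)}"

definition Const :: "bool \<Rightarrow> boolfun set" where
  "Const c = {f \<in> Omega. \<forall>a \<in> tuples (arity f). val f a = c}"

definition Consts :: "boolfun set" where
  "Consts = Const False \<union> Const True"

text \<open>\<open>val0 X a\<close>, \<open>val1 X b\<close> and \<open>val01 X a b\<close> are \<open>X\<close> with subscript \<open>a*\<close>, \<open>*b\<close> and \<open>ab\<close>.\<close>

definition val0 :: "boolfun set \<Rightarrow> bool \<Rightarrow> boolfun set" where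
  "val0 X a = {f \<in> X. at0 f = a}"

definition val1 :: "boolfun set \<Rightarrow> bool \<Rightarrow> boolfun set" where
  "val1 X b = {f \<in> X. at1 f = b}"

definition val01 :: "boolfun set \<Rightarrow> bool \<Rightarrow> bool \<Rightarrow> boolfun set" where
  "val01 X a b = val0 X a \<inter> val1 X b"

definition Omega_eq :: "boolfun set" where
  "Omega_eq = {f \<in> Omega. at0 f = at1 f}"

definition Omega_le :: "boolfun set" where
  "Omega_le = {f \<in> Omega. at0 f \<le> at1 f}"

definition Omega_ge :: "boolfun set" where
  "Omega_ge = {f \<in> Omega. at0 f \<ge> at1 f}"


subsection \<open>Quasiorders\<close>

definition minorant :: "boolfun \<Rightarrow> boolfun \<Rightarrow> bool" where
  "minorant f g \<longleftrightarrow> f \<in> Omega \<and> g \<in> Omega \<and> arity f = arity g \<and>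
     (\<forall>a \<in> tuples (arity f). val f a \<le> val g a)"

definition minor :: "boolfun \<Rightarrow> boolfun \<Rightarrow> bool" where
  "minor f g \<longleftrightarrow> f \<in> Omega \<and> g \<in> Omega \<and>
     (\<exists>\<sigma>. (\<forall>i < arity g. \<sigma> i < arity f) \<and>
        f = mkfun (arity f) (\<lambda>a. val g (map (\<lambda>i. a ! \<sigma> i) [0..<arity g])))"

definition sqle :: "boolfun \<Rightarrow> boolfun \<Rightarrow> bool" where
  "sqle = (\<lambda>f g. minorant f g \<or> minor f g)\<^sup>+\<^sup>+"

definition downset :: "boolfun set \<Rightarrow> boolfun set" where
  "downset X = {f \<in> Omega. \<exists>x \<in> X. sqle f x}"

text \<open>
  \<open>least_majorant C f g\<close> expresses that \<open>g\<close> is the least majorant of \<open>f\<close> in \<open>C\<close>.  It is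
  unique by antisymmetry, and exists for all the \<open>C\<close> used below, because they contain
  the constant 1 functions and are closed under pointwise meets.
\<close>

definition least_majorant :: "boolfun set \<Rightarrow> boolfun \<Rightarrow> boolfun \<Rightarrow> bool" where
  "least_majorant C f g \<longleftrightarrow> g \<in> C \<and> minorant f g \<and> (\<forall>h \<in> C. minorant f h \<longrightarrow> minorant g h)"

definition sqle_in :: "boolfun set \<Rightarrow> boolfun \<Rightarrow> boolfun \<Rightarrow> bool" where
  "sqle_in C = (\<lambda>f g. minorant f g \<or> minor f g \<or> least_majorant C g f)\<^sup>+\<^sup>+"


subsection \<open>Ideals and the classes they determine\<close>

definition Omega_upto :: "nat \<Rightarrow> boolfun set" where
  "Omega_upto k = {f \<in> Omega. card (ones f) \<le> k}"

definition Ideals :: "nat \<Rightarrow> boolfun set set" where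
  "Ideals k = {\<Theta>. \<Theta> \<subseteq> Omega_upto k \<and>
     (\<forall>f \<in> Omega_upto k. \<forall>\<theta> \<in> \<Theta>. sqle f \<theta> \<longrightarrow> f \<in> \<Theta>)}"

definition Ideals_in :: "nat \<Rightarrow> boolfun set \<Rightarrow> boolfun set set" where
  "Ideals_in k C = {\<Theta>. \<Theta> \<subseteq> Omega_upto k \<and>
     (\<forall>f \<in> Omega_upto k. \<forall>\<theta> \<in> \<Theta>. sqle_in C f \<theta> \<longrightarrow> f \<in> \<Theta>)}"

definition U :: "nat \<Rightarrow> boolfun set \<Rightarrow> boolfun set" where
  "U k \<Theta> = {f \<in> Omega. \<forall>T. T \<subseteq> ones f \<and> card T \<le> k \<longrightarrow> chi (arity f) T \<in> downset \<Theta>}"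

end

theory Submission
  imports Defs
begin

text \<open>
  Fix a clonoid \<open>K\<close> and an arity \<open>n\<close>.  Because \<open>K\<close> is closed under every monotone \<open>h\<close> with
  \<open>h(0) = 0\<close>, \<open>h(1) = 1\<close> whose true points intersect \<open>k\<close> at a time, membership of an \<open>n\<close>-ary
  \<open>f\<close> in \<open>K\<close> is a local matter (\<open>clonoid_interpolation\<close>).  It is enough that at most \<open>k\<close> true
  points of \<open>f\<close> at a time are covered by a member of \<open>K\<close>, that each pair of a true point and a
  false point of \<open>f\<close> is separated by a member of \<open>K\<close>, and that each false point of \<open>f\<close> is a
  false point of a member of \<open>K\<close>.  The reason is a one-step construction: feed the list of
  \<^emph>\<open>all\<close> \<open>n\<close>-ary members of \<open>K\<close> into the least monotone function that has the required values
  on the rows \<open>(g(a))\<^sub>g\<close>; the three conditions ensure that this function lies in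
  \<open>MU01 k\<close> and that the composition is \<open>f\<close>.

  The covering condition describes a class \<open>U k \<Theta>\<close>, where \<open>\<Theta>\<close> consists of the minorants of members of
  \<open>K\<close> with at most \<open>k\<close> true points.  The separation condition depends on a pair \<open>(t, y)\<close> only
  through the set \<open>P\<close> of the pairs \<open>(t\<^sub>i, y\<^sub>i)\<close>, since \<open>K\<close> is closed under minors
  (\<open>separating_member\<close>).  The pairs with pattern set inside \<open>P\<close> are inseparable by \<open>K\<close> exactly
  if \<open>K\<close> is contained in the class \<open>preserving P\<close>, and the sixteen sets \<open>P\<close> yield besides \<open>Omega\<close>
  only ten classes (\<open>preserving_cases\<close>): functions with \<open>f(0) \<le> f(1)\<close>, or \<open>f(0) \<ge> f(1)\<close>, functions
  with least or greatest value at one of the two constant tuples, monotone, antitone, reflexive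
  and constant functions.  Finally, the condition on false points fails only if \<open>f\<close> is
  constant 0 and all members of \<open>K\<close> have the value 1 at the same constant tuple.  Hence \<open>K\<close> is the
  intersection of \<open>U k \<Theta>\<close> with those of twelve explicit classes that contain \<open>K\<close>
  (\<open>clonoid_membership\<close>).

  What remains is to see which combinations of the twelve classes occur.  They are ruled by the
  values at the two constant tuples; for example, a monotone function with value 1 at the zero tuple
  is constant 1.  If \<open>K\<close> contains a constant 1 function, then the covering condition is void, and
  the combinations are \<open>Omega\<close> and the finitely many listed classes (\<open>clonoid_with_Const_True\<close>).
  Otherwise no member of \<open>K\<close> has the value 1 at both constant tuples, as identifying all its variables
  would give a constant 1.  Since \<open>k \<ge> 2\<close>, the covering condition passes this on to the members
  of \<open>U k \<Theta>\<close>.  So the classes with \<open>f(0) \<le> f(1)\<close>, with \<open>f(0) \<ge> f(1)\<close> with least value at a constant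
  tuple, or of constant functions impose nothing on \<open>U k \<Theta>\<close>, and the possible restrictions are to monotone, antitone or reflexive
  functions, to greatest value at a constant tuple, and to value 1 there
  (\<open>clonoid_without_Const_True\<close>).  The ideal property of \<open>\<Theta>\<close> for the least majorants in a class \<open>D\<close>
  holds because each member of \<open>K\<close> lies below a member of \<open>K\<close> in \<open>D\<close>.

  Conversely, \<open>U k \<Theta>\<close>, the classes \<open>preserving P\<close> and the classes given by a value at a constant
  tuple are clonoids, and every class in the list is an intersection of such classes.
\<close>

section \<open>Boolean functions and tuples\<close>

lemma finite_tuples: "finite (tuples n)"
  using finite_lists_length_eq[of "UNIV :: bool set" n] by (simp add: tuples_def)

lemma replicate_in_tuples [simp]: "replicate n c \<in> tuples n"
  by (simp add: tuples_def)

lemma mkfun_in_Omega [simp]: "mkfun n h \<in> Omega \<longleftrightarrow> 1 \<le> n"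
  by (simp add: mkfun_def Omega_def)

lemma arity_mkfun [simp]: "arity (mkfun n h) = n"
  by (simp add: mkfun_def)

lemma val_mkfun [simp]: "a \<in> tuples n \<Longrightarrow> val (mkfun n h) a = h a"
  by (simp add: mkfun_def)

lemma arity_pos: "f \<in> Omega \<Longrightarrow> 1 \<le> arity f"
  by (simp add: Omega_def)

lemma boolfun_eqI:
  assumes "f \<in> Omega" "g \<in> Omega" "arity f = arity g"
    and "\<And>a. a \<in> tuples (arity f) \<Longrightarrow> val f a = val g a"
  shows "f = g"
proof -
  have "val f = val g"
    using assms by (intro PiE_ext[of _ "tuples (arity f)" "\<lambda>_. UNIV"]) (auto simp: Omega_def)
  then show ?thesis using assms(3) by (simp add: prod_eq_iff)
qed

lemma tuple_le_map: "tuple_le (map p xs) (map q xs) \<longleftrightarrow> (\<forall>x \<in> set xs. p x \<longrightarrow> q x)"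
  by (auto simp: tuple_le_def list_all2_map1 list_all2_map2 list_all2_same)

lemma ones_chi: "T \<subseteq> tuples n \<Longrightarrow> ones (chi n T) = T"
  by (auto simp: ones_def chi_def)

lemma minorant_refl: "f \<in> Omega \<Longrightarrow> minorant f f"
  by (simp add: minorant_def)

lemma minorant_trans: "minorant f g \<Longrightarrow> minorant g h \<Longrightarrow> minorant f h"
  by (auto simp: minorant_def)

lemma minorant_chi_iff:
  assumes "g \<in> Omega" "T \<subseteq> tuples (arity g)"
  shows "minorant (chi (arity g) T) g \<longleftrightarrow> T \<subseteq> ones g"
  using assms arity_pos[of g] by (auto simp: minorant_def chi_def ones_def)

section \<open>Minors and clonoids\<close>

definition reindex :: "nat \<Rightarrow> (nat \<Rightarrow> nat) \<Rightarrow> boolfun \<Rightarrow> boolfun" where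
  "reindex n \<sigma> g = mkfun n (\<lambda>a. val g (map (\<lambda>i. a ! \<sigma> i) [0..<arity g]))"

lemma minor_iff_reindex:
  "minor f g \<longleftrightarrow> f \<in> Omega \<and> g \<in> Omega \<and>
     (\<exists>\<sigma>. (\<forall>i < arity g. \<sigma> i < arity f) \<and> f = reindex (arity f) \<sigma> g)"
  by (simp add: minor_def reindex_def)

lemma reindex_in_Omega:
  assumes "g \<in> Omega" "\<forall>i < arity g. \<sigma> i < n"
  shows "reindex n \<sigma> g \<in> Omega"
proof -
  have "\<sigma> 0 < n" using assms arity_pos[of g] by auto
  then show ?thesis by (simp add: reindex_def)
qed

lemma arity_reindex [simp]: "arity (reindex n \<sigma> g) = n"
  by (simp add: reindex_def)

lemma val_reindex:
  "a \<in> tuples n \<Longrightarrow> val (reindex n \<sigma> g) a = val g (map (\<lambda>i. a ! \<sigma> i) [0..<arity g])"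
  by (simp add: reindex_def)

lemma reindex_eq_compose:
  assumes "\<forall>i < arity g. \<sigma> i < n"
  shows "reindex n \<sigma> g = compose_fun g n (map (\<lambda>i. mkfun n (\<lambda>a. a ! \<sigma> i)) [0..<arity g])"
  unfolding reindex_def compose_fun_def
  by (auto simp: mkfun_def restrict_def fun_eq_iff comp_def)

lemma projection_in_Proj: "i < n \<Longrightarrow> mkfun n (\<lambda>a. a ! i) \<in> Proj"
  unfolding Proj_def by blast

lemma class_compI:
  "f \<in> I \<Longrightarrow> length gs = arity f \<Longrightarrow> \<forall>g \<in> set gs. g \<in> J \<and> arity g = n \<Longrightarrow> compose_fun f n gs \<in> class_comp I J"
  unfolding class_comp_def by blast

text \<open>Composition with projections is substitution of variables for variables, so closure under
  \<open>Proj\<close> from the right is closure under minors.\<close>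

lemma class_comp_Proj:
  assumes "K \<subseteq> Omega"
  shows "class_comp K Proj = {reindex n \<sigma> g | n \<sigma> g. g \<in> K \<and> (\<forall>i < arity g. \<sigma> i < n)}"
    (is "_ = ?R")
proof (rule set_eqI, rule iffI)
  fix h assume "h \<in> class_comp K Proj"
  then obtain g n gs where g: "g \<in> K" "length gs = arity g"
    and gs: "\<forall>p \<in> set gs. p \<in> Proj \<and> arity p = n" and h: "h = compose_fun g n gs"
    unfolding class_comp_def by blast
  have "\<exists>\<sigma>. \<forall>i < arity g. \<sigma> i < n \<and> gs ! i = mkfun n (\<lambda>a. a ! \<sigma> i)"
  proof (intro choice allI)
    fix i
    show "\<exists>j. i < arity g \<longrightarrow> j < n \<and> gs ! i = mkfun n (\<lambda>a. a ! j)"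
    proof (cases "i < arity g")
      case True
      then have "gs ! i \<in> Proj" "arity (gs ! i) = n" using gs g by auto
      then show ?thesis by (auto simp: Proj_def)
    qed auto
  qed
  then obtain \<sigma> where \<sigma>: "\<forall>i < arity g. \<sigma> i < n \<and> gs ! i = mkfun n (\<lambda>a. a ! \<sigma> i)" by blast
  then have "gs = map (\<lambda>i. mkfun n (\<lambda>a. a ! \<sigma> i)) [0..<arity g]"
    using g by (auto intro: nth_equalityI)
  then have "h = reindex n \<sigma> g" using h \<sigma> reindex_eq_compose by simp
  then show "h \<in> ?R" using g \<sigma> by blast
next
  fix h assume "h \<in> ?R"
  then obtain n \<sigma> g where g: "g \<in> K" "\<forall>i < arity g. \<sigma> i < n" "h = reindex n \<sigma> g" by blast
  let ?gs = "map (\<lambda>i. mkfun n (\<lambda>a. a ! \<sigma> i)) [0..<arity g]"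
  have "\<forall>p \<in> set ?gs. p \<in> Proj \<and> arity p = n" using g(2) projection_in_Proj by auto
  then have "compose_fun g n ?gs \<in> class_comp K Proj" by (intro class_compI g(1)) simp
  then show "h \<in> class_comp K Proj" using g(3) reindex_eq_compose[OF g(2)] by (simp only:)
qed

lemma clonoid_reindex:
  assumes "clonoid Proj C K" "g \<in> K" "\<forall>i < arity g. \<sigma> i < n"
  shows "reindex n \<sigma> g \<in> K"
proof -
  have "reindex n \<sigma> g \<in> class_comp K Proj"
    using assms class_comp_Proj[of K] unfolding clonoid_def by blast
  then show ?thesis using assms(1) unfolding clonoid_def by blast
qed

lemma clonoid_compose:
  assumes "clonoid C1 C2 K" "f \<in> C2" "length gs = arity f" "\<And>g. g \<in> set gs \<Longrightarrow> g \<in> K \<and> arity g = n"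
  shows "compose_fun f n gs \<in> K"
proof -
  have "compose_fun f n gs \<in> class_comp C2 K" using assms by (intro class_compI) auto
  then show ?thesis using assms(1) by (auto simp: clonoid_def)
qed

lemma clonoidI:
  assumes "K \<subseteq> Omega" "C \<subseteq> Omega"
    and "\<And>n \<sigma> g. g \<in> K \<Longrightarrow> \<forall>i < arity g. \<sigma> i < n \<Longrightarrow> 1 \<le> n \<Longrightarrow> reindex n \<sigma> g \<in> K"
    and "\<And>f n gs. f \<in> C \<Longrightarrow> length gs = arity f \<Longrightarrow> \<forall>g \<in> set gs. g \<in> K \<and> arity g = n \<Longrightarrow> 1 \<le> n
           \<Longrightarrow> compose_fun f n gs \<in> K"
  shows "clonoid Proj C K"
proof -
  have 1: "1 \<le> n" if "g \<in> K" "\<forall>i < arity g. \<sigma> i < n" for g n and \<sigma> :: "nat \<Rightarrow> nat"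
  proof -
    have "\<sigma> 0 < n" using that assms(1) arity_pos[of g] by auto
    then show ?thesis by simp
  qed
  have 2: "1 \<le> n" if "f \<in> C" "length gs = arity f" "\<forall>g \<in> set gs. g \<in> K \<and> arity g = n"
    for f n and gs :: "boolfun list"
  proof -
    have "gs ! 0 \<in> set gs" using that assms(2) arity_pos[of f] by (intro nth_mem) auto
    then show ?thesis using that assms(1) arity_pos[of "gs ! 0"] by auto
  qed
  have "class_comp K Proj \<subseteq> K"
    unfolding class_comp_Proj[OF assms(1)] using assms(3) 1 by blast
  moreover have "class_comp C K \<subseteq> K"
    unfolding class_comp_def using assms(4) 2 by blast
  ultimately show ?thesis using assms(1) by (simp add: clonoid_def)
qed

lemma clonoid_Int:
  assumes "clonoid C1 C2 A" "clonoid C1 C2 B"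
  shows "clonoid C1 C2 (A \<inter> B)"
proof -
  have "class_comp (A \<inter> B) C1 \<subseteq> class_comp A C1 \<inter> class_comp B C1"
    "class_comp C2 (A \<inter> B) \<subseteq> class_comp C2 A \<inter> class_comp C2 B"
    unfolding class_comp_def by blast+
  then show ?thesis using assms unfolding clonoid_def by blast
qed

lemma MU01_subset_Omega: "MU01 k \<subseteq> Omega"
  by (auto simp: MU01_def Mon_def)

lemma MU01_mono:
  assumes "f \<in> MU01 k" "length xs = arity f" "\<And>x. x \<in> set xs \<Longrightarrow> p x \<Longrightarrow> q x"
    and "val f (map p xs)"
  shows "val f (map q xs)"
proof -
  have "map p xs \<in> tuples (arity f)" "map q xs \<in> tuples (arity f)"
    using assms(2) by (simp_all add: tuples_def)
  moreover have "tuple_le (map p xs) (map q xs)" using assms(3) by (simp add: tuple_le_map)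
  ultimately have "val f (map p xs) \<le> val f (map q xs)"
    using assms(1) unfolding MU01_def Mon_def by blast
  then show ?thesis using assms(4) by simp
qed

section \<open>Classes determined by a set of column patterns\<close>

text \<open>Two tuples are read as the rows of a matrix; \<open>P\<close> is the set of its admissible columns.  These
  classes formalize the implications \<open>f(t) \<le> f(y)\<close> that are stable under minors.\<close>

definition preserving :: "(bool \<times> bool) set \<Rightarrow> boolfun set" where
  "preserving P = {f \<in> Omega. \<forall>t \<in> tuples (arity f). \<forall>y \<in> tuples (arity f).
     set (zip t y) \<subseteq> P \<longrightarrow> val f t \<longrightarrow> val f y}"

text \<open>A minor only repeats or drops columns of the matrix with rows \<open>t\<close> and \<open>y\<close>, and a monotone outer
  function preserves the order between the values of the inner functions at \<open>t\<close> and at \<open>y\<close>.\<close>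

lemma clonoid_preserving: "clonoid Proj (MU01 k) (preserving P)"
proof (rule clonoidI)
  show "preserving P \<subseteq> Omega" by (auto simp: preserving_def)
  show "MU01 k \<subseteq> Omega" by (rule MU01_subset_Omega)
next
  fix n :: nat and \<sigma> :: "nat \<Rightarrow> nat" and g :: boolfun
  assume g: "g \<in> preserving P" and \<sigma>: "\<forall>i < arity g. \<sigma> i < n"
  show "reindex n \<sigma> g \<in> preserving P"
    unfolding preserving_def
  proof (intro CollectI conjI ballI impI)
    show "reindex n \<sigma> g \<in> Omega" using g \<sigma> by (intro reindex_in_Omega) (auto simp: preserving_def)
  next
    fix t y assume ty: "t \<in> tuples (arity (reindex n \<sigma> g))" "y \<in> tuples (arity (reindex n \<sigma> g))"
      "set (zip t y) \<subseteq> P" "val (reindex n \<sigma> g) t"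
    let ?t = "map (\<lambda>i. t ! \<sigma> i) [0..<arity g]" and ?y = "map (\<lambda>i. y ! \<sigma> i) [0..<arity g]"
    have "set (zip ?t ?y) \<subseteq> set (zip t y)"
    proof
      fix p assume "p \<in> set (zip ?t ?y)"
      then obtain i where i: "i < arity g" "p = (t ! \<sigma> i, y ! \<sigma> i)" by (auto simp: set_zip)
      then show "p \<in> set (zip t y)" using \<sigma> ty(1,2) by (auto simp: set_zip tuples_def)
    qed
    then have "set (zip ?t ?y) \<subseteq> P" using ty(3) by blast
    moreover have "?t \<in> tuples (arity g)" "?y \<in> tuples (arity g)" by (simp_all add: tuples_def)
    ultimately have "val g ?t \<longrightarrow> val g ?y" using g unfolding preserving_def by blast
    then show "val (reindex n \<sigma> g) y" using ty by (simp add: val_reindex)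
  qed
next
  fix f n gs assume f: "f \<in> MU01 k" and len: "length gs = arity f"
    and gs: "\<forall>g \<in> set gs. g \<in> preserving P \<and> arity g = n" and "1 \<le> n"
  show "compose_fun f n gs \<in> preserving P"
    unfolding preserving_def
  proof (intro CollectI conjI ballI impI)
    show "compose_fun f n gs \<in> Omega" using \<open>1 \<le> n\<close> by (simp add: compose_fun_def)
  next
    fix t y assume ty: "t \<in> tuples (arity (compose_fun f n gs))" "y \<in> tuples (arity (compose_fun f n gs))"
      "set (zip t y) \<subseteq> P" "val (compose_fun f n gs) t"
    have "val f (map (\<lambda>g. val g y) gs)"
      using f len
    proof (rule MU01_mono)
      show "val f (map (\<lambda>g. val g t) gs)" using ty by (simp add: compose_fun_def)
    next
      fix g assume "g \<in> set gs" "val g t"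
      then show "val g y" using gs ty by (auto simp: preserving_def compose_fun_def)
    qed
    then show "val (compose_fun f n gs) y" using ty by (simp add: compose_fun_def)
  qed
qed

text \<open>Substituting variables maps constant tuples to constant tuples, and the members of \<open>MU01 k\<close>
  are idempotent; so a prescribed value at a constant tuple defines a clonoid.\<close>

lemma at_reindex:
  assumes "\<forall>i < arity g. \<sigma> i < n"
  shows "at0 (reindex n \<sigma> g) = at0 g" "at1 (reindex n \<sigma> g) = at1 g"
proof -
  have "map (\<lambda>i. replicate n c ! \<sigma> i) [0..<arity g] = replicate (arity g) c" for c :: bool
    using assms by (auto intro: nth_equalityI)
  then show "at0 (reindex n \<sigma> g) = at0 g" "at1 (reindex n \<sigma> g) = at1 g"
    by (simp_all add: at0_def at1_def val_reindex)
qed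

lemma MU01_const:
  assumes "f \<in> MU01 k" "length xs = arity f" "\<And>x. x \<in> set xs \<Longrightarrow> p x = c"
  shows "val f (map p xs) = c"
proof -
  have "map p xs = replicate (arity f) c"
    using assms(2,3) by (intro nth_equalityI) auto
  then show ?thesis using assms(1) by (cases c) (auto simp: MU01_def at0_def at1_def)
qed

lemma clonoid_val0: "clonoid Proj (MU01 k) (val0 Omega c)"
proof (rule clonoidI)
  fix f n gs assume f: "f \<in> MU01 k" "length gs = arity f"
    and gs: "\<forall>g \<in> set gs. g \<in> val0 Omega c \<and> arity g = n" and "1 \<le> n"
  have "val f (map (\<lambda>g. val g (replicate n False)) gs) = c"
    by (rule MU01_const[OF f]) (use gs in \<open>auto simp: val0_def at0_def\<close>)
  then show "compose_fun f n gs \<in> val0 Omega c"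
    using \<open>1 \<le> n\<close> by (simp add: val0_def at0_def compose_fun_def)
qed (auto simp: val0_def at_reindex reindex_in_Omega MU01_subset_Omega)

lemma clonoid_val1: "clonoid Proj (MU01 k) (val1 Omega c)"
proof (rule clonoidI)
  fix f n gs assume f: "f \<in> MU01 k" "length gs = arity f"
    and gs: "\<forall>g \<in> set gs. g \<in> val1 Omega c \<and> arity g = n" and "1 \<le> n"
  have "val f (map (\<lambda>g. val g (replicate n True)) gs) = c"
    by (rule MU01_const[OF f]) (use gs in \<open>auto simp: val1_def at1_def\<close>)
  then show "compose_fun f n gs \<in> val1 Omega c"
    using \<open>1 \<le> n\<close> by (simp add: val1_def at1_def compose_fun_def)
qed (auto simp: val1_def at_reindex reindex_in_Omega MU01_subset_Omega)


section \<open>Majorized functions and the classes \<open>U\<close>\<close>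

definition majorized :: "boolfun set \<Rightarrow> boolfun set" where
  "majorized K = {f. \<exists>g \<in> K. minorant f g}"

text \<open>Taking minors commutes with taking minorants, hence the minorants of members of a class that is
  closed under minors already form the whole downset.\<close>

lemma majorized_step:
  assumes K: "\<And>g n \<sigma>. g \<in> K \<Longrightarrow> \<forall>i < arity g. \<sigma> i < n \<Longrightarrow> reindex n \<sigma> g \<in> K"
    and "minorant f g \<or> minor f g" "g \<in> majorized K"
  shows "f \<in> majorized K"
proof -
  obtain h where h: "h \<in> K" "minorant g h" using assms(3) by (auto simp: majorized_def)
  from assms(2) show ?thesis
  proof
    assume "minorant f g"
    then show ?thesis using h minorant_trans unfolding majorized_def by blast
  next
    assume "minor f g"
    then obtain \<sigma> where \<sigma>: "\<forall>i < arity g. \<sigma> i < arity f" "f = reindex (arity f) \<sigma> g"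
      and "f \<in> Omega" "g \<in> Omega" by (auto simp: minor_iff_reindex)
    have ar: "arity g = arity h" "h \<in> Omega" using h(2) by (auto simp: minorant_def)
    have "reindex (arity f) \<sigma> h \<in> K" using K[OF h(1)] \<sigma>(1) ar by simp
    moreover have "minorant f (reindex (arity f) \<sigma> h)"
    proof -
      have "val f a \<longrightarrow> val (reindex (arity f) \<sigma> h) a" if a: "a \<in> tuples (arity f)" for a
      proof -
        have "val f a = val g (map (\<lambda>i. a ! \<sigma> i) [0..<arity g])"
          by (subst \<sigma>(2)) (rule val_reindex[OF a])
        moreover have "map (\<lambda>i. a ! \<sigma> i) [0..<arity g] \<in> tuples (arity g)"
          by (simp add: tuples_def)
        ultimately show ?thesis using h(2) a ar by (auto simp: val_reindex minorant_def)
      qed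
      then show ?thesis
        using \<open>f \<in> Omega\<close> reindex_in_Omega[of h \<sigma> "arity f"] \<sigma>(1) ar by (auto simp: minorant_def)
    qed
    ultimately show ?thesis by (auto simp: majorized_def)
  qed
qed

lemma minorant_sqle: "minorant f g \<Longrightarrow> sqle f g"
  unfolding sqle_def by blast

lemma minor_sqle: "minor f g \<Longrightarrow> sqle f g"
  unfolding sqle_def by blast

lemma sqle_refl: "f \<in> Omega \<Longrightarrow> sqle f f"
  unfolding sqle_def using minorant_refl by blast

lemma sqle_trans: "sqle f g \<Longrightarrow> sqle g h \<Longrightarrow> sqle f h"
  unfolding sqle_def by (rule tranclp_trans)

text \<open>For a minor \<open>g\<^sub>\<sigma>\<close>, a set \<open>T\<close> of true points is mapped by \<open>\<sigma>\<close> to a set of no more true points of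
  \<open>g\<close>.  For a composition, the rows of \<open>T\<close> are at most \<open>k\<close> true points of the outer
  function, so they share a coordinate with value 1; this coordinate is an inner function that is
  true on all of \<open>T\<close>.\<close>

lemma clonoid_U: "clonoid Proj (MU01 k) (U k \<Theta>)"
proof (rule clonoidI)
  show "U k \<Theta> \<subseteq> Omega" by (auto simp: U_def)
  show "MU01 k \<subseteq> Omega" by (rule MU01_subset_Omega)
next
  fix n :: nat and \<sigma> :: "nat \<Rightarrow> nat" and g :: boolfun
  assume g: "g \<in> U k \<Theta>" and \<sigma>: "\<forall>i < arity g. \<sigma> i < n" and n: "1 \<le> n"
  have gO: "g \<in> Omega" using g by (simp add: U_def)
  let ?f = "\<lambda>a. map (\<lambda>i. a ! \<sigma> i) [0..<arity g]"
  have f_tuple: "?f a \<in> tuples (arity g)" for a :: "bool list" by (simp add: tuples_def)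
  have "chi n T \<in> downset \<Theta>" if T: "T \<subseteq> ones (reindex n \<sigma> g)" "card T \<le> k" for T
  proof -
    have fin: "finite T" using T(1) finite_tuples[of n] by (auto simp: ones_def intro: finite_subset)
    have Tn: "T \<subseteq> tuples n" using T(1) by (auto simp: ones_def)
    have sub: "?f ` T \<subseteq> ones g" using T(1) f_tuple by (auto simp: ones_def val_reindex)
    let ?h = "chi (arity g) (?f ` T)"
    have "card (?f ` T) \<le> k" using card_image_le[OF fin, of ?f] T(2) by simp
    then have "?h \<in> downset \<Theta>" using g sub by (auto simp: U_def)
    then obtain x where x: "x \<in> \<Theta>" "sqle ?h x" by (auto simp: downset_def)
    have hO: "?h \<in> Omega" "arity ?h = arity g" using gO arity_pos by (auto simp: chi_def)
    have "minor (reindex n \<sigma> ?h) ?h"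
      unfolding minor_iff_reindex using hO \<sigma> reindex_in_Omega[of ?h \<sigma> n] by auto
    moreover have "minorant (chi n T) (reindex n \<sigma> ?h)"
      using n hO \<sigma> reindex_in_Omega[of ?h \<sigma> n] f_tuple
      by (auto simp: minorant_def chi_def val_reindex)
    ultimately have "sqle (chi n T) ?h" using minor_sqle minorant_sqle sqle_trans by blast
    then have "sqle (chi n T) x" using x(2) sqle_trans by blast
    moreover have "chi n T \<in> Omega" using n by (simp add: chi_def)
    ultimately show ?thesis using x(1) unfolding downset_def by blast
  qed
  then show "reindex n \<sigma> g \<in> U k \<Theta>" using reindex_in_Omega[OF gO \<sigma>] by (auto simp: U_def)
next
  fix f n gs assume f: "f \<in> MU01 k" and len: "length gs = arity f"
    and gs: "\<forall>g \<in> set gs. g \<in> U k \<Theta> \<and> arity g = n" and n: "1 \<le> n"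
  let ?h = "compose_fun f n gs" and ?row = "\<lambda>a. map (\<lambda>g. val g a) gs"
  have "chi n T \<in> downset \<Theta>" if T: "T \<subseteq> ones ?h" "card T \<le> k" for T
  proof -
    have fin: "finite T"
      using T(1) finite_tuples[of n] by (auto simp: ones_def compose_fun_def intro: finite_subset)
    have "?row ` T \<subseteq> ones f"
      using T(1) len by (auto simp: ones_def compose_fun_def tuples_def)
    moreover have "card (?row ` T) \<le> k" using card_image_le[OF fin, of ?row] T(2) by simp
    ultimately have "meet (arity f) (?row ` T) \<noteq> replicate (arity f) False"
      using f by (auto simp: MU01_def)
    then obtain i where i: "i < arity f" "\<forall>a \<in> ?row ` T. a ! i"
      by (auto simp: meet_def list_eq_iff_nth_eq)
    then have "T \<subseteq> ones (gs ! i)"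
      using T(1) len gs by (auto simp: ones_def compose_fun_def)
    moreover have "gs ! i \<in> U k \<Theta>" "arity (gs ! i) = n" using gs i len by auto
    ultimately show ?thesis using T(2) by (auto simp: U_def)
  qed
  then show "?h \<in> U k \<Theta>" using n by (auto simp: U_def compose_fun_def)
qed

section \<open>Interpolation in a clonoid\<close>

text \<open>The \<open>n\<close>-ary members of \<open>K\<close> form a finite list \<open>gs\<close>, and a tuple \<open>a\<close> has the row of the values
  of \<open>gs\<close> at \<open>a\<close>.  Then \<open>f\<close> is the composition with \<open>gs\<close> of the least monotone function \<open>F\<close>
  that is true on the rows of the true points of \<open>f\<close> and on the tuple of ones.  By separation, no row of a
  false point lies above the row of a true point; by covering, at most \<open>k\<close> true points of \<open>F\<close> have a
  common coordinate 1, namely a member of \<open>K\<close> that is true on the corresponding true points of \<open>f\<close>.\<close>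

lemma clonoid_interpolation:
  assumes K: "clonoid Proj (MU01 k) K" and f: "f \<in> Omega"
    and cover: "\<And>T. T \<subseteq> ones f \<Longrightarrow> card T \<le> k \<Longrightarrow> \<exists>g \<in> K. arity g = arity f \<and> T \<subseteq> ones g"
    and sep: "\<And>t y. t \<in> ones f \<Longrightarrow> y \<in> tuples (arity f) \<Longrightarrow> \<not> val f y \<Longrightarrow>
                \<exists>g \<in> K. arity g = arity f \<and> val g t \<and> \<not> val g y"
    and zero: "\<And>y. y \<in> tuples (arity f) \<Longrightarrow> \<not> val f y \<Longrightarrow> \<exists>g \<in> K. arity g = arity f \<and> \<not> val g y"
    and k: "1 \<le> k"
  shows "f \<in> K"
proof -
  let ?n = "arity f" and ?Kn = "{g \<in> K. arity g = arity f}"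
  have KO: "K \<subseteq> Omega" using K by (simp add: clonoid_def)
  have "?Kn \<subseteq> Pair ?n ` (tuples ?n \<rightarrow>\<^sub>E UNIV)"
    using KO by (force simp: Omega_def)
  moreover have "finite (tuples ?n \<rightarrow>\<^sub>E (UNIV :: bool set))"
    by (intro finite_PiE finite_tuples) auto
  ultimately have "finite ?Kn" by (meson finite_imageI finite_subset)
  then obtain gs where gs: "set gs = ?Kn" using finite_list by blast
  let ?row = "\<lambda>a. map (\<lambda>g. val g a) gs"
  let ?N = "length gs"
  \<comment> \<open>The tuple of ones is added because \<open>F\<close> must be true there even if \<open>f\<close> is constant 0; it is
    not the row of a false point by \<open>zero\<close>.\<close>
  define F where "F = mkfun ?N (\<lambda>v. v = replicate ?N True \<or> (\<exists>t \<in> ones f. tuple_le (?row t) v))"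
  have valF: "val F v \<longleftrightarrow> v = replicate ?N True \<or> (\<exists>t \<in> ones f. tuple_le (?row t) v)"
    if "v \<in> tuples ?N" for v using that by (simp add: F_def)
  have arF: "arity F = ?N" by (simp add: F_def)
  have "?Kn \<noteq> {}" using cover[of "{}"] by auto
  then have N: "1 \<le> ?N" using gs by (cases gs) auto
  have row_tuple: "?row a \<in> tuples ?N" for a by (simp add: tuples_def)
  have "F \<in> MU01 k"
    unfolding MU01_def
  proof (intro CollectI conjI allI impI)
    show "F \<in> Mon"
      unfolding Mon_def
    proof (intro CollectI conjI ballI impI)
      show "F \<in> Omega" using N by (simp add: F_def)
    next
      fix a b assume ab: "a \<in> tuples (arity F)" "b \<in> tuples (arity F)" "tuple_le a b"
      have "b = replicate ?N True" if "a = replicate ?N True"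
        using that ab arF by (auto simp: tuple_le_def list_all2_conv_all_nth tuples_def intro: nth_equalityI)
      moreover have "tuple_le c b" if "tuple_le c a" for c
        using that ab(3) by (auto simp: tuple_le_def list_all2_conv_all_nth)
      ultimately show "val F a \<le> val F b" using ab arF valF by (auto simp: le_bool_def)
    qed
  next
    have "\<not> tuple_le (?row t) (replicate ?N False)" if "t \<in> ones f" for t
    proof -
      have "\<exists>g \<in> K. arity g = ?n \<and> {t} \<subseteq> ones g"
        by (rule cover) (use that k in auto)
      then obtain g where "g \<in> K" "arity g = ?n" "{t} \<subseteq> ones g" by blast
      then have "g \<in> set gs" "val g t" using gs by (simp_all add: ones_def)
      then show ?thesis by (auto simp: tuple_le_def list_all2_conv_all_nth in_set_conv_nth)
    qed
    moreover have "replicate ?N False \<noteq> replicate ?N True" using N by (cases gs) auto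
    ultimately show "\<not> at0 F" using arF by (simp add: at0_def valF)
    show "at1 F" using arF by (simp add: at1_def valF)
  next
    fix V assume V: "V \<subseteq> ones F \<and> card V \<le> k"
    then have Vn: "V \<subseteq> tuples ?N" by (auto simp: ones_def arF)
    have fin: "finite V" using Vn finite_tuples finite_subset by blast
    let ?one = "replicate ?N True"
    have "\<exists>t \<in> ones f. tuple_le (?row t) v" if "v \<in> V - {?one}" for v
      using that V Vn valF by (auto simp: ones_def arF)
    \<comment> \<open>\<open>s v\<close> is a true point of \<open>f\<close> whose row lies below \<open>v\<close>.\<close>
    then obtain s where s: "\<And>v. v \<in> V - {?one} \<Longrightarrow> s v \<in> ones f \<and> tuple_le (?row (s v)) v"
      by metis
    have "card (s ` (V - {?one})) \<le> card V"
      using fin by (meson card_image_le card_mono Diff_subset finite_Diff le_trans)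
    moreover have "s ` (V - {?one}) \<subseteq> ones f" using s by auto
    ultimately obtain g where g: "g \<in> set gs" "s ` (V - {?one}) \<subseteq> ones g"
      using cover[of "s ` (V - {?one})"] V gs by auto
    then obtain i where i: "i < ?N" "g = gs ! i" by (auto simp: in_set_conv_nth)
    have "v ! i" if "v \<in> V" for v
    proof (cases "v = ?one")
      case False
      then have "tuple_le (?row (s v)) v" "val g (s v)" using that s[of v] g(2) by (auto simp: ones_def)
      then show ?thesis using i by (auto simp: tuple_le_def list_all2_conv_all_nth)
    qed (use i in simp)
    then have "meet ?N V ! i" using i by (simp add: meet_def)
    then show "meet (arity F) V \<noteq> replicate (arity F) False" using i arF by auto
  qed
  then have "compose_fun F ?n gs \<in> K"
    using clonoid_compose[OF K, of F gs ?n] gs arF by auto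
  moreover have "compose_fun F ?n gs = f"
  proof (rule boolfun_eqI)
    show "compose_fun F ?n gs \<in> Omega" using f arity_pos by (simp add: compose_fun_def)
    fix a assume "a \<in> tuples (arity (compose_fun F ?n gs))"
    then have a: "a \<in> tuples ?n" by (simp add: compose_fun_def)
    have "val F (?row a) \<longleftrightarrow> val f a"
    proof
      assume "val f a"
      then have "a \<in> ones f" using a by (simp add: ones_def)
      then show "val F (?row a)" using valF[OF row_tuple] by (auto simp: tuple_le_map)
    next
      assume *: "val F (?row a)"
      show "val f a"
      proof (rule ccontr)
        assume na: "\<not> val f a"
        have "?row a \<noteq> replicate ?N True"
        proof -
          obtain g where "g \<in> set gs" "\<not> val g a" using zero[OF a na] gs by auto
          then have "False \<in> set (?row a)" by auto
          then show ?thesis by (metis in_set_replicate)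
        qed
        then obtain t where t: "t \<in> ones f" "tuple_le (?row t) (?row a)"
          using * valF[OF row_tuple] by auto
        then show False using sep[OF t(1) a na] gs by (auto simp: tuple_le_map)
      qed
    qed
    then show "val (compose_fun F ?n gs) a = val f a" using a by (simp add: compose_fun_def)
  qed (use f in \<open>auto simp: compose_fun_def\<close>)
  ultimately show ?thesis by simp
qed

text \<open>If \<open>g\<close> separates \<open>t'\<close> from \<open>y'\<close>, and each column of \<open>(t', y')\<close> occurs in \<open>(t, y)\<close>, then picking
  such a column for each variable of \<open>g\<close> gives a minor of \<open>g\<close> that separates \<open>t\<close> from \<open>y\<close>.\<close>

lemma separating_member:
  assumes K: "clonoid Proj C K" and ty: "t \<in> tuples n" "y \<in> tuples n"
    and "\<not> K \<subseteq> preserving (set (zip t y))"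
  shows "\<exists>g \<in> K. arity g = n \<and> val g t \<and> \<not> val g y"
proof -
  have KO: "K \<subseteq> Omega" using K by (simp add: clonoid_def)
  obtain g t' y' where g: "g \<in> K" "t' \<in> tuples (arity g)" "y' \<in> tuples (arity g)"
    "set (zip t' y') \<subseteq> set (zip t y)" "val g t'" "\<not> val g y'"
    using assms(4) KO by (auto simp: preserving_def)
  have "\<exists>j < n. t ! j = t' ! i \<and> y ! j = y' ! i" if "i < arity g" for i
  proof -
    have "(t' ! i, y' ! i) \<in> set (zip t' y')" using that g(2,3) by (auto simp: set_zip tuples_def)
    then have "(t' ! i, y' ! i) \<in> set (zip t y)" using g(4) by blast
    then show ?thesis using ty by (auto simp: set_zip tuples_def)
  qed
  then obtain \<sigma> where \<sigma>: "\<And>i. i < arity g \<Longrightarrow> \<sigma> i < n \<and> t ! \<sigma> i = t' ! i \<and> y ! \<sigma> i = y' ! i"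
    by metis
  have "map (\<lambda>i. t ! \<sigma> i) [0..<arity g] = t'" "map (\<lambda>i. y ! \<sigma> i) [0..<arity g] = y'"
    using \<sigma> g(2,3) by (auto simp: tuples_def intro: nth_equalityI)
  then have "val (reindex n \<sigma> g) t" "\<not> val (reindex n \<sigma> g) y"
    using g ty by (simp_all add: val_reindex)
  moreover have "reindex n \<sigma> g \<in> K" using clonoid_reindex[OF K g(1)] \<sigma> by blast
  ultimately show ?thesis by (intro bexI[of _ "reindex n \<sigma> g"]) auto
qed


section \<open>The pattern classes by name\<close>

lemma zip_subset_iff:
  "t \<in> tuples n \<Longrightarrow> y \<in> tuples n \<Longrightarrow> set (zip t y) \<subseteq> P \<longleftrightarrow> (\<forall>i < n. (t ! i, y ! i) \<in> P)"
  by (auto simp: set_zip tuples_def)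

lemma eq_replicate_iff: "t \<in> tuples n \<Longrightarrow> t = replicate n c \<longleftrightarrow> (\<forall>i < n. t ! i = c)"
  by (auto simp: tuples_def list_eq_iff_nth_eq)

lemma tuple_le_iff:
  "t \<in> tuples n \<Longrightarrow> y \<in> tuples n \<Longrightarrow> tuple_le t y \<longleftrightarrow> (\<forall>i < n. t ! i \<longrightarrow> y ! i)"
  by (auto simp: tuples_def tuple_le_def list_all2_conv_all_nth)

lemma in_preservingI:
  assumes "f \<in> Omega"
    and "\<And>t y. t \<in> tuples (arity f) \<Longrightarrow> y \<in> tuples (arity f) \<Longrightarrow>
           \<forall>i < arity f. (t ! i, y ! i) \<in> P \<Longrightarrow> val f t \<Longrightarrow> val f y"
  shows "f \<in> preserving P"
  using assms by (simp add: preserving_def zip_subset_iff)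

lemma in_preservingD:
  assumes "f \<in> preserving P" "val f t" "t \<in> tuples (arity f)" "y \<in> tuples (arity f)"
    "\<And>i. i < arity f \<Longrightarrow> (t ! i, y ! i) \<in> P"
  shows "val f y"
  using assms by (simp add: preserving_def zip_subset_iff)

lemma preserving_subset_Omega: "preserving P \<subseteq> Omega"
  by (auto simp: preserving_def)

lemma Mon_bar_iff_antitone:
  "Mon_bar = {f \<in> Omega. \<forall>a \<in> tuples (arity f). \<forall>b \<in> tuples (arity f).
     tuple_le a b \<longrightarrow> val f b \<longrightarrow> val f a}" (is "_ = ?R")
proof (rule set_eqI, rule iffI)
  fix f assume "f \<in> Mon_bar"
  then show "f \<in> ?R" using arity_pos by (auto simp: Mon_bar_def neg_def Mon_def)
next
  fix f assume f: "f \<in> ?R"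
  then have "neg f \<in> Mon" using arity_pos by (auto simp: neg_def Mon_def)
  moreover have "f = neg (neg f)"
    using f arity_pos by (intro boolfun_eqI) (auto simp: neg_def)
  ultimately show "f \<in> Mon_bar" by (auto simp: Mon_bar_def)
qed

lemma preserving_diagonal:
  assumes "P \<subseteq> {(False, False), (True, True)}"
  shows "preserving P = Omega"
proof -
  have "f \<in> preserving P" if "f \<in> Omega" for f
  proof (rule in_preservingI[OF that])
    fix t y assume ty: "t \<in> tuples (arity f)" "y \<in> tuples (arity f)"
      "\<forall>i < arity f. (t ! i, y ! i) \<in> P" and "val f t"
    have "t ! i = y ! i" if "i < arity f" for i using ty(3) that assms by auto
    then have "t = y" using ty(1,2) by (auto simp: tuples_def intro: nth_equalityI)
    then show "val f y" using \<open>val f t\<close> by simp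
  qed
  then show ?thesis by (auto simp: preserving_def)
qed

text \<open>If both patterns agree in one row, then that row is a constant tuple and the other row is
  arbitrary.\<close>

lemma pattern_iff:
  assumes "t \<in> tuples n" "y \<in> tuples n"
  shows "set (zip t y) \<subseteq> {(a, b)} \<longleftrightarrow> t = replicate n a \<and> y = replicate n b"
    and "set (zip t y) \<subseteq> {(c, b), (\<not> c, b)} \<longleftrightarrow> y = replicate n b"
    and "set (zip t y) \<subseteq> {(a, c), (a, \<not> c)} \<longleftrightarrow> t = replicate n a"
    and "set (zip t y) \<subseteq> {(False, False), (False, True), (True, True)} \<longleftrightarrow> tuple_le t y"
    and "set (zip t y) \<subseteq> {(False, False), (True, False), (True, True)} \<longleftrightarrow> tuple_le y t"
    and "set (zip t y) \<subseteq> {(False, True), (True, False)} \<longleftrightarrow> y = map Not t"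
proof -
  have "y = map Not t \<longleftrightarrow> (\<forall>i < n. y ! i = (\<not> t ! i))"
    using assms by (auto simp: tuples_def list_eq_iff_nth_eq)
  then show "set (zip t y) \<subseteq> {(False, True), (True, False)} \<longleftrightarrow> y = map Not t"
    using assms by (auto simp: zip_subset_iff)
qed (use assms in \<open>auto simp: zip_subset_iff eq_replicate_iff tuple_le_iff\<close>)

lemmas pattern_simps = pattern_iff pattern_iff(2)[where c = True, simplified]
  pattern_iff(2)[where c = False, simplified] pattern_iff(3)[where c = True, simplified]
  pattern_iff(3)[where c = False, simplified]

text \<open>The elements of the pattern sets are listed in the order in which the simplifier sorts them by
  commutation of \<open>insert\<close>, so that the equations below apply to the simplified form of \<open>P\<close> in
  \<open>preserving_cases\<close>.\<close>

lemma preserving_ge: "preserving {(True, False)} = Omega_ge"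
  by (auto simp: preserving_def pattern_simps Omega_ge_def at0_def at1_def le_bool_def)

lemma preserving_le: "preserving {(False, True)} = Omega_le"
  by (auto simp: preserving_def pattern_simps Omega_le_def at0_def at1_def le_bool_def)

lemma preserving_below_value0: "preserving {(False, False), (True, False)} = val0 Omega True \<union> Consts"
  by (auto simp: preserving_def pattern_simps val0_def at0_def Consts_def Const_def)

lemma preserving_below_value1: "preserving {(False, True), (True, True)} = val1 Omega True \<union> Consts"
  by (auto simp: preserving_def pattern_simps val1_def at1_def Consts_def Const_def)

lemma preserving_above_value0: "preserving {(False, False), (False, True)} = val0 Omega False \<union> Consts"
  by (auto simp: preserving_def pattern_simps val0_def at0_def Consts_def Const_def)

lemma preserving_above_value1: "preserving {(True, False), (True, True)} = val1 Omega False \<union> Consts"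
  by (auto simp: preserving_def pattern_simps val1_def at1_def Consts_def Const_def)

lemma preserving_Mon: "preserving {(False, False), (False, True), (True, True)} = Mon"
  by (auto simp: preserving_def pattern_simps Mon_def le_bool_def)

lemma preserving_Mon_bar: "preserving {(False, False), (True, False), (True, True)} = Mon_bar"
  by (auto simp: preserving_def pattern_simps Mon_bar_iff_antitone)

lemma preserving_Reflexive: "preserving {(False, True), (True, False)} = Reflexive"
proof -
  have "map Not t \<in> tuples n" "map Not (map Not t) = t" if "t \<in> tuples n" for t n
    using that by (auto simp: tuples_def comp_def)
  note Not_tuple = this
  have "f \<in> preserving {(False, True), (True, False)} \<longleftrightarrow> f \<in> Reflexive" for f
  proof
    assume f: "f \<in> preserving {(False, True), (True, False)}"
    have imp: "val f t \<longrightarrow> val f (map Not t)" if "t \<in> tuples (arity f)" for t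
      using f that Not_tuple(1)[OF that] by (simp add: preserving_def pattern_simps)
    have "val f t = val f (map Not t)" if "t \<in> tuples (arity f)" for t
      using imp[OF that] imp[OF Not_tuple(1)[OF that]] Not_tuple(2)[OF that] by auto
    then show "f \<in> Reflexive" using f by (simp add: preserving_def Reflexive_def)
  next
    assume "f \<in> Reflexive"
    then show "f \<in> preserving {(False, True), (True, False)}"
      unfolding preserving_def Reflexive_def by (simp add: pattern_simps)
  qed
  then show ?thesis by blast
qed

text \<open>With both mixed patterns and \<open>(c, c)\<close> present, every tuple is admissible together with the
  constant tuple \<open>(c, \<dots>, c)\<close> in both orders, so every value equals the value there.\<close>

lemma preserving_Consts:
  assumes "{(False, True), (True, False)} \<subseteq> P" "(c, c) \<in> P"
  shows "preserving P = Consts"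
proof -
  have "f \<in> Consts" if "f \<in> preserving P" for f
  proof -
    let ?c = "replicate (arity f) c"
    have "val f a = val f ?c" if a: "a \<in> tuples (arity f)" for a
    proof -
      have 1: "(a ! i, ?c ! i) \<in> P" "(?c ! i, a ! i) \<in> P" if "i < arity f" for i
        using that assms by (cases "a ! i"; cases c; simp)+
      have "val f ?c" if "val f a"
        by (rule in_preservingD[OF \<open>f \<in> preserving P\<close> that a _ 1(1)]) simp_all
      moreover have "val f a" if "val f ?c"
        by (rule in_preservingD[OF \<open>f \<in> preserving P\<close> that _ a 1(2)]) simp_all
      ultimately show ?thesis by blast
    qed
    then have "f \<in> Const (val f ?c)" using that preserving_subset_Omega unfolding Const_def by blast
    then show ?thesis by (cases "val f ?c") (simp_all add: Consts_def)
  qed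
  then show ?thesis by (auto simp: preserving_def Consts_def Const_def)
qed

definition basic_classes :: "boolfun set set" where
  "basic_classes = {Omega_le, Omega_ge, val0 Omega False \<union> Consts, val1 Omega False \<union> Consts,
     val0 Omega True \<union> Consts, val1 Omega True \<union> Consts, Mon, Mon_bar, Reflexive, Consts}"

text \<open>The mixed patterns in \<open>P\<close> decide between trivial, order-like, symmetric and constant classes; the
  diagonal patterns \<open>c\<close> and \<open>d\<close> refine the order-like ones.\<close>

lemma preserving_cases: "preserving P = Omega \<or> preserving P \<in> basic_classes"
proof -
  have P: "P = (if a then {(True, False)} else {}) \<union> (if b then {(False, True)} else {}) \<union>
      (if c then {(False, False)} else {}) \<union> (if d then {(True, True)} else {})"
    if "a \<longleftrightarrow> (True, False) \<in> P" "b \<longleftrightarrow> (False, True) \<in> P" "c \<longleftrightarrow> (False, False) \<in> P" "d \<longleftrightarrow> (True, True) \<in> P"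
    for a b c d
  proof (rule set_eqI)
    fix p :: "bool \<times> bool"
    obtain u v where "p = (u, v)" by fastforce
    then show "p \<in> P \<longleftrightarrow> p \<in> (if a then {(True, False)} else {}) \<union> (if b then {(False, True)} else {}) \<union>
        (if c then {(False, False)} else {}) \<union> (if d then {(True, True)} else {})"
      using that by (cases u; cases v) simp_all
  qed
  define c d where "c \<longleftrightarrow> (False, False) \<in> P" and "d \<longleftrightarrow> (True, True) \<in> P"
  consider (diag) "(True, False) \<notin> P" "(False, True) \<notin> P"
    | (gt) "(True, False) \<in> P" "(False, True) \<notin> P"
    | (lt) "(True, False) \<notin> P" "(False, True) \<in> P"
    | (both) "(True, False) \<in> P" "(False, True) \<in> P" by blast
  then show ?thesis
  proof cases
    case diag
    have "P = {} \<union> {} \<union> (if c then {(False, False)} else {}) \<union> (if d then {(True, True)} else {})"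
      using P[of False False c d] diag c_def d_def by simp
    also have "\<dots> \<subseteq> {(False, False), (True, True)}" by auto
    finally show ?thesis by (intro disjI1 preserving_diagonal)
  next
    case gt
    then show ?thesis using P[of True False c d] c_def d_def
      by (cases c; cases d) (simp_all add: basic_classes_def preserving_ge preserving_below_value0
          preserving_above_value1 preserving_Mon_bar)
  next
    case lt
    then show ?thesis using P[of False True c d] c_def d_def
      by (cases c; cases d) (simp_all add: basic_classes_def preserving_le preserving_below_value1
          preserving_above_value0 preserving_Mon)
  next
    case both
    show ?thesis
    proof (cases "c \<or> d")
      case True
      then have "preserving P = Consts"
        using both c_def d_def preserving_Consts[of P True] preserving_Consts[of P False] by blast
      then show ?thesis by (simp add: basic_classes_def)
    next
      case False
      then show ?thesis using P[of True True c d] both c_def d_def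
        by (simp add: basic_classes_def preserving_Reflexive)
    qed
  qed
qed

lemma clonoid_basic:
  assumes "B \<in> basic_classes"
  shows "clonoid Proj (MU01 k) B"
proof -
  have "\<exists>P. B = preserving P"
    using assms preserving_ge preserving_le preserving_below_value0 preserving_below_value1 preserving_above_value0
      preserving_above_value1 preserving_Mon preserving_Mon_bar preserving_Reflexive
      preserving_Consts[of UNIV]
    unfolding basic_classes_def by blast
  then show ?thesis using clonoid_preserving by blast
qed

section \<open>The membership criterion\<close>

definition ideal_of :: "nat \<Rightarrow> boolfun set \<Rightarrow> boolfun set" where
  "ideal_of k K = majorized K \<inter> Omega_upto k"

lemma backwards_closed_tranclp:
  assumes "\<And>f g. R f g \<Longrightarrow> g \<in> S \<Longrightarrow> f \<in> S" "R\<^sup>+\<^sup>+ f g" "g \<in> S"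
  shows "f \<in> S"
  using assms(2,3) by (induction rule: tranclp_induct) (use assms(1) in blast)+

lemma majorized_sqle:
  assumes "clonoid Proj C K" "sqle f g" "g \<in> majorized K"
  shows "f \<in> majorized K"
  by (rule backwards_closed_tranclp[OF _ assms(2)[unfolded sqle_def] assms(3)])
    (use majorized_step clonoid_reindex[OF assms(1)] in blast)

text \<open>If every member of \<open>K\<close> lies below one in \<open>D\<close>, then a majorized \<open>g\<close> lies below
  some \<open>h \<in> K \<inter> D\<close>, and therefore so does its least majorant in \<open>D\<close>.\<close>

lemma majorized_sqle_in:
  assumes K: "clonoid Proj C K" and D: "\<And>g. g \<in> K \<Longrightarrow> \<exists>h \<in> K \<inter> D. minorant g h"
    and "sqle_in D f g" "g \<in> majorized K"
  shows "f \<in> majorized K"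
proof (rule backwards_closed_tranclp[OF _ assms(3)[unfolded sqle_in_def] assms(4)])
  fix f g :: boolfun
  assume R: "minorant f g \<or> minor f g \<or> least_majorant D g f" and g: "g \<in> majorized K"
  show "f \<in> majorized K"
  proof (cases "least_majorant D g f")
    case False
    then show ?thesis using R majorized_step clonoid_reindex[OF K] g by blast
  next
    case True
    obtain h where "h \<in> K \<inter> D" "minorant g h"
      using g D minorant_trans unfolding majorized_def by blast
    then show ?thesis using True by (auto simp: majorized_def least_majorant_def)
  qed
qed

lemma ideal_of_Ideals: "clonoid Proj C K \<Longrightarrow> ideal_of k K \<in> Ideals k"
  using majorized_sqle unfolding ideal_of_def Ideals_def by blast

lemma ideal_of_Ideals_in:
  assumes "clonoid Proj C K" "\<And>g. g \<in> K \<Longrightarrow> \<exists>h \<in> K \<inter> D. minorant g h"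
  shows "ideal_of k K \<in> Ideals_in k D"
  using majorized_sqle_in[OF assms] unfolding ideal_of_def Ideals_in_def by blast

text \<open>For at most \<open>k\<close> true points, \<open>\<chi>\<^sub>T\<close> is itself a candidate for the ideal, so the condition
  in the definition of \<open>U\<close> says that \<open>\<chi>\<^sub>T\<close> is below a member of \<open>K\<close>.\<close>

lemma mem_U_ideal_of:
  assumes K: "clonoid Proj C K"
  shows "f \<in> U k (ideal_of k K) \<longleftrightarrow> f \<in> Omega \<and>
    (\<forall>T. T \<subseteq> ones f \<and> card T \<le> k \<longrightarrow> (\<exists>g \<in> K. arity g = arity f \<and> T \<subseteq> ones g))"
proof -
  have "chi (arity f) T \<in> downset (ideal_of k K) \<longleftrightarrow> (\<exists>g \<in> K. arity g = arity f \<and> T \<subseteq> ones g)"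
    if f: "f \<in> Omega" and T: "T \<subseteq> ones f" "card T \<le> k" for T
  proof -
    let ?c = "chi (arity f) T"
    have Tn: "T \<subseteq> tuples (arity f)" using T(1) by (auto simp: ones_def)
    then have c: "?c \<in> Omega_upto k" "arity ?c = arity f"
      using T(2) arity_pos[OF f] by (auto simp: Omega_upto_def ones_chi) (auto simp: chi_def)
    have "?c \<in> downset (ideal_of k K) \<longleftrightarrow> ?c \<in> majorized K"
    proof
      assume "?c \<in> downset (ideal_of k K)"
      then show "?c \<in> majorized K"
        using majorized_sqle[OF K] unfolding downset_def ideal_of_def by blast
    next
      assume "?c \<in> majorized K"
      moreover have "?c \<in> Omega" using c by (simp add: Omega_upto_def)
      ultimately show "?c \<in> downset (ideal_of k K)"
        using c sqle_refl unfolding downset_def ideal_of_def by blast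
    qed
    also have "\<dots> \<longleftrightarrow> (\<exists>g \<in> K. arity g = arity f \<and> T \<subseteq> ones g)"
    proof -
      have "minorant ?c g \<longleftrightarrow> arity g = arity f \<and> T \<subseteq> ones g" if "g \<in> K" for g
      proof (cases "arity g = arity f")
        case True
        then show ?thesis using that K Tn minorant_chi_iff[of g T] by (auto simp: clonoid_def)
      qed (use c(2) in \<open>simp add: minorant_def\<close>)
      then show ?thesis unfolding majorized_def by blast
    qed
    finally show ?thesis .
  qed
  then show ?thesis unfolding U_def by blast
qed

lemma clonoid_subset_U: "clonoid Proj C K \<Longrightarrow> K \<subseteq> U k (ideal_of k K)"
  using mem_U_ideal_of unfolding clonoid_def by blast

text \<open>The two classes with value 1 at a constant tuple are the only obstacles to a constant 0: if neither
  contains \<open>K\<close>, then minors in one variable of members of \<open>K\<close> are false at any given tuple.\<close>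

lemma clonoid_membership:
  assumes K: "clonoid Proj (MU01 k) K" and k: "1 \<le> k"
  shows "f \<in> K \<longleftrightarrow> f \<in> U k (ideal_of k K) \<and> (\<forall>B \<in> basic_classes. K \<subseteq> B \<longrightarrow> f \<in> B) \<and>
     (K \<subseteq> val0 Omega True \<longrightarrow> f \<in> val0 Omega True) \<and> (K \<subseteq> val1 Omega True \<longrightarrow> f \<in> val1 Omega True)"
    (is "_ \<longleftrightarrow> ?R")
proof
  assume "f \<in> K"
  then show ?R using clonoid_subset_U[OF K] by blast
next
  assume R: ?R
  let ?n = "arity f"
  have f: "f \<in> Omega" using R by (simp add: U_def)
  have KO: "K \<subseteq> Omega" using K by (simp add: clonoid_def)
  have sep: "\<exists>g \<in> K. arity g = arity f \<and> val g t \<and> \<not> val g y"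
    if ty: "t \<in> ones f" "y \<in> tuples ?n" "\<not> val f y" for t y
  proof (rule separating_member[OF K])
    have "f \<notin> preserving (set (zip t y))" using ty by (auto simp: preserving_def ones_def)
    then show "\<not> K \<subseteq> preserving (set (zip t y))"
      using preserving_cases[of "set (zip t y)"] R f by auto
  qed (use ty in \<open>auto simp: ones_def\<close>)
  show "f \<in> K"
  proof (rule clonoid_interpolation[OF K f _ sep _ k])
    fix y assume y: "y \<in> tuples ?n" "\<not> val f y"
    show "\<exists>g \<in> K. arity g = ?n \<and> \<not> val g y"
    proof (cases "ones f = {}")
      case False
      then show ?thesis using sep y by blast
    next
      case True
      have "0 < ?n" using arity_pos[OF f] by simp
      \<comment> \<open>\<open>K\<close> has a member that is false at the constant tuple \<open>c\<close>; made to depend on the first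
        variable alone, it is false at \<open>y\<close>.\<close>
      define c where "c = y ! 0"
      have "\<exists>g \<in> K. \<not> val g (replicate (arity g) c)"
      proof -
        have "f \<notin> val0 Omega True" "f \<notin> val1 Omega True"
          using True by (auto simp: val0_def val1_def at0_def at1_def ones_def)
        then have "\<not> K \<subseteq> val0 Omega True" "\<not> K \<subseteq> val1 Omega True" using R by auto
        then show ?thesis using KO by (cases c) (auto simp: val0_def val1_def at0_def at1_def)
      qed
      then obtain g where g: "g \<in> K" "\<not> val g (replicate (arity g) c)" by blast
      have "reindex ?n (\<lambda>_. 0) g \<in> K" using clonoid_reindex[OF K g(1)] \<open>0 < ?n\<close> by simp
      moreover have "\<not> val (reindex ?n (\<lambda>_. 0) g) y"
        using g y by (simp add: val_reindex c_def map_replicate_trivial flip: map_replicate_const)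
      ultimately show ?thesis by (intro bexI[of _ "reindex ?n (\<lambda>_. 0) g"]) auto
    qed
  qed (use R mem_U_ideal_of[OF K] in auto)
qed


section \<open>Values at the constant tuples\<close>

lemma Const_facts:
  "f \<in> Const False \<Longrightarrow> f \<in> Omega \<and> \<not> at0 f \<and> \<not> at1 f \<and> f \<in> Mon \<and> f \<in> Mon_bar \<and> f \<in> Reflexive"
  "f \<in> Const True \<Longrightarrow> f \<in> Omega \<and> at0 f \<and> at1 f \<and> f \<in> Mon \<and> f \<in> Mon_bar \<and> f \<in> Reflexive"
  by (auto simp: Const_def at0_def at1_def Mon_def Mon_bar_iff_antitone Reflexive_def tuples_def)

lemma Mon_facts:
  assumes "f \<in> Mon"
  shows "f \<in> Omega" "at0 f \<Longrightarrow> f \<in> Const True" "\<not> at1 f \<Longrightarrow> f \<in> Const False"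
proof -
  have "tuple_le (replicate (arity f) False) a" "tuple_le a (replicate (arity f) True)"
    if "a \<in> tuples (arity f)" for a
    using that by (auto simp: tuple_le_iff[of _ "arity f"])
  then show "f \<in> Omega" "at0 f \<Longrightarrow> f \<in> Const True" "\<not> at1 f \<Longrightarrow> f \<in> Const False"
    using assms replicate_in_tuples unfolding Mon_def Const_def at0_def at1_def le_bool_def by blast+
qed

lemma Mon_bar_facts:
  assumes "f \<in> Mon_bar"
  shows "f \<in> Omega" "at1 f \<Longrightarrow> f \<in> Const True" "\<not> at0 f \<Longrightarrow> f \<in> Const False"
proof -
  have "tuple_le (replicate (arity f) False) a" "tuple_le a (replicate (arity f) True)"
    if "a \<in> tuples (arity f)" for a
    using that by (auto simp: tuple_le_iff[of _ "arity f"])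
  then show "f \<in> Omega" "at1 f \<Longrightarrow> f \<in> Const True" "\<not> at0 f \<Longrightarrow> f \<in> Const False"
    using assms replicate_in_tuples unfolding Mon_bar_iff_antitone Const_def at0_def at1_def by blast+
qed

lemma Reflexive_facts:
  assumes "f \<in> Reflexive"
  shows "f \<in> Omega" "at0 f \<longleftrightarrow> at1 f"
proof -
  have "f \<in> Omega \<and> val f (replicate (arity f) False) = val f (map Not (replicate (arity f) False))"
    using assms replicate_in_tuples unfolding Reflexive_def by blast
  then show "f \<in> Omega" "at0 f \<longleftrightarrow> at1 f" by (simp_all add: at0_def at1_def)
qed

lemmas endpoint_facts = Const_facts Mon_facts Mon_bar_facts Reflexive_facts

lemma class_simps:
  "f \<in> Omega_le \<longleftrightarrow> f \<in> Omega \<and> (at0 f \<longrightarrow> at1 f)"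
  "f \<in> Omega_ge \<longleftrightarrow> f \<in> Omega \<and> (at1 f \<longrightarrow> at0 f)"
  "f \<in> Omega_eq \<longleftrightarrow> f \<in> Omega \<and> (at0 f \<longleftrightarrow> at1 f)"
  "f \<in> val0 X a \<longleftrightarrow> f \<in> X \<and> at0 f = a"
  "f \<in> val1 X b \<longleftrightarrow> f \<in> X \<and> at1 f = b"
  "f \<in> val01 X a b \<longleftrightarrow> f \<in> X \<and> at0 f = a \<and> at1 f = b"
  "f \<in> Consts \<longleftrightarrow> f \<in> Const False \<or> f \<in> Const True"
  by (auto simp: Omega_le_def Omega_ge_def Omega_eq_def val0_def val1_def val01_def Consts_def)

text \<open>For one function, these relations hold between the values at the constant tuples and the
  classes; in combination with \<open>class_simps\<close> they reduce equalities of classes to propositional logic.\<close>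

lemma endpoint_relations:
  "(f \<in> Const False \<longrightarrow> f \<in> Omega \<and> \<not> at0 f \<and> \<not> at1 f \<and> f \<in> Mon \<and> f \<in> Mon_bar \<and> f \<in> Reflexive) \<and>
   (f \<in> Const True \<longrightarrow> f \<in> Omega \<and> at0 f \<and> at1 f \<and> f \<in> Mon \<and> f \<in> Mon_bar \<and> f \<in> Reflexive) \<and>
   (f \<in> Mon \<longrightarrow> f \<in> Omega \<and> (at0 f \<longrightarrow> f \<in> Const True) \<and> (\<not> at1 f \<longrightarrow> f \<in> Const False)) \<and>
   (f \<in> Mon_bar \<longrightarrow> f \<in> Omega \<and> (at1 f \<longrightarrow> f \<in> Const True) \<and> (\<not> at0 f \<longrightarrow> f \<in> Const False)) \<and>
   (f \<in> Reflexive \<longrightarrow> f \<in> Omega \<and> (at0 f \<longleftrightarrow> at1 f))"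
  using endpoint_facts[of f] by blast

lemma subset_by_members:
  assumes "\<And>f. f \<in> A \<Longrightarrow> f \<in> B \<Longrightarrow> f \<in> C"
  shows "K \<subseteq> A \<and> K \<subseteq> B \<longrightarrow> K \<subseteq> C"
  using assms by blast

text \<open>The same relations lifted to inclusions of \<open>K\<close>.\<close>

lemma inclusion_relations:
  assumes "K \<subseteq> Omega"
  shows "K \<subseteq> Mon \<and> K \<subseteq> Omega_ge \<longrightarrow> K \<subseteq> Consts"
    and "K \<subseteq> Mon \<and> K \<subseteq> Mon_bar \<longrightarrow> K \<subseteq> Consts"
    and "K \<subseteq> Mon_bar \<and> K \<subseteq> Omega_le \<longrightarrow> K \<subseteq> Consts"
    and "K \<subseteq> val0 Omega True \<union> Consts \<and> K \<subseteq> val0 Omega False \<union> Consts \<longrightarrow> K \<subseteq> Consts"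
    and "K \<subseteq> val1 Omega True \<union> Consts \<and> K \<subseteq> val1 Omega False \<union> Consts \<longrightarrow> K \<subseteq> Consts"
    and "K \<subseteq> val0 Omega True \<union> Consts \<and> K \<subseteq> Omega \<longrightarrow> K \<subseteq> Omega_ge"
    and "K \<subseteq> val1 Omega False \<union> Consts \<and> K \<subseteq> Omega \<longrightarrow> K \<subseteq> Omega_ge"
    and "K \<subseteq> val0 Omega False \<union> Consts \<and> K \<subseteq> Omega \<longrightarrow> K \<subseteq> Omega_le"
    and "K \<subseteq> val1 Omega True \<union> Consts \<and> K \<subseteq> Omega \<longrightarrow> K \<subseteq> Omega_le"
    and "K \<subseteq> Reflexive \<and> K \<subseteq> Omega \<longrightarrow> K \<subseteq> Omega_le"
    and "K \<subseteq> Reflexive \<and> K \<subseteq> Omega \<longrightarrow> K \<subseteq> Omega_ge"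
    and "K \<subseteq> Mon \<and> K \<subseteq> Omega \<longrightarrow> K \<subseteq> Omega_le"
    and "K \<subseteq> Mon_bar \<and> K \<subseteq> Omega \<longrightarrow> K \<subseteq> Omega_ge"
    and "K \<subseteq> val0 Omega True \<longrightarrow> K \<subseteq> val0 Omega True \<union> Consts"
    and "K \<subseteq> val1 Omega True \<longrightarrow> K \<subseteq> val1 Omega True \<union> Consts"
    and "K \<subseteq> Omega_le \<and> K \<subseteq> val0 Omega True \<longrightarrow> K \<subseteq> val1 Omega True"
    and "K \<subseteq> Omega_ge \<and> K \<subseteq> val1 Omega True \<longrightarrow> K \<subseteq> val0 Omega True"
    and "K \<subseteq> Omega_eq \<and> K \<subseteq> val0 Omega True \<union> Consts \<longrightarrow> K \<subseteq> val1 Omega True \<union> Consts"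
    and "K \<subseteq> Omega_eq \<and> K \<subseteq> val1 Omega True \<union> Consts \<longrightarrow> K \<subseteq> val0 Omega True \<union> Consts"
    and "K \<subseteq> Omega_eq \<and> K \<subseteq> val0 Omega False \<union> Consts \<longrightarrow> K \<subseteq> val1 Omega False \<union> Consts"
    and "K \<subseteq> Omega_eq \<and> K \<subseteq> val1 Omega False \<union> Consts \<longrightarrow> K \<subseteq> val0 Omega False \<union> Consts"
    and "K \<subseteq> Omega_le \<and> K \<subseteq> Omega_ge \<longrightarrow> K \<subseteq> Omega_eq"
    and "K \<subseteq> Omega"
  by ((rule subset_by_members, rename_tac f, cut_tac f = f in endpoint_relations,
        unfold class_simps Un_iff, argo) | (use assms in blast))+

section \<open>Clonoids with a constant 1 function\<close>

text \<open>Here every set of true points is covered, so \<open>K\<close> is determined by which of the twelve classes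
  contain it.  The case distinction follows these inclusions; in each case the inclusion relations leave
  at most three of them open.\<close>

lemma clonoid_with_Const_True:
  assumes K: "clonoid Proj (MU01 k) K" and k: "1 \<le> k" and one: "K \<inter> Const True \<noteq> {}"
  shows "K \<in> {Omega, Omega_le, Omega_ge, Omega_eq,
         val0 Omega False \<union> Consts, val1 Omega False \<union> Consts,
         val0 Omega True \<union> Consts, val1 Omega True \<union> Consts,
         val01 Omega False False \<union> Consts, val01 Omega False True \<union> Consts,
         val01 Omega True False \<union> Consts, val01 Omega True True \<union> Consts,
         val01 Omega False True \<union> Const True, val01 Omega True False \<union> Const True,
         val0 Omega True, val1 Omega True, val01 Omega True True,
         Mon, val1 Mon True, Mon_bar, val0 Mon_bar True,
         Reflexive, val01 Reflexive False False \<union> Consts, val01 Reflexive True True \<union> Consts,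
         val01 Reflexive True True,
         Consts, Const True}"
proof -
  have KO: "K \<subseteq> Omega" using K by (simp add: clonoid_def)
  have full: "f \<in> U k (ideal_of k K)" if f: "f \<in> Omega" for f
  proof -
    obtain c where c: "c \<in> K" "c \<in> Const True" using one by blast
    let ?c = "reindex (arity f) (\<lambda>_. 0) c"
    have "?c \<in> K" using clonoid_reindex[OF K c(1)] arity_pos[OF f] by auto
    moreover have "ones ?c = tuples (arity f)"
      using c(2) by (auto simp: ones_def val_reindex Const_def tuples_def)
    ultimately show ?thesis
      using f unfolding mem_U_ideal_of[OF K] by (auto simp: ones_def intro!: bexI[of _ ?c])
  qed
  \<comment> \<open>\<open>f0\<close>, \<open>f1\<close>: the value at the tuple of zeros (ones) is the least value; \<open>t0\<close>, \<open>t1\<close>: it is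
    the greatest value; \<open>v0\<close>, \<open>v1\<close>: it is 1.\<close>
  let ?l = "K \<subseteq> Omega_le" and ?g = "K \<subseteq> Omega_ge"
    and ?f0 = "K \<subseteq> val0 Omega False \<union> Consts" and ?f1 = "K \<subseteq> val1 Omega False \<union> Consts"
    and ?t0 = "K \<subseteq> val0 Omega True \<union> Consts" and ?t1 = "K \<subseteq> val1 Omega True \<union> Consts"
    and ?v0 = "K \<subseteq> val0 Omega True" and ?v1 = "K \<subseteq> val1 Omega True"
    and ?m = "K \<subseteq> Mon" and ?a = "K \<subseteq> Mon_bar" and ?r = "K \<subseteq> Reflexive" and ?c = "K \<subseteq> Consts"
  have mem: "f \<in> K \<longleftrightarrow> f \<in> Omega \<and> (?l \<longrightarrow> f \<in> Omega_le) \<and> (?g \<longrightarrow> f \<in> Omega_ge) \<and>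
      (?f0 \<longrightarrow> f \<in> val0 Omega False \<union> Consts) \<and> (?f1 \<longrightarrow> f \<in> val1 Omega False \<union> Consts) \<and>
      (?t0 \<longrightarrow> f \<in> val0 Omega True \<union> Consts) \<and> (?t1 \<longrightarrow> f \<in> val1 Omega True \<union> Consts) \<and>
      (?v0 \<longrightarrow> f \<in> val0 Omega True) \<and> (?v1 \<longrightarrow> f \<in> val1 Omega True) \<and>
      (?m \<longrightarrow> f \<in> Mon) \<and> (?a \<longrightarrow> f \<in> Mon_bar) \<and> (?r \<longrightarrow> f \<in> Reflexive) \<and> (?c \<longrightarrow> f \<in> Consts)" for f
  proof -
    have "f \<in> U k (ideal_of k K) \<longleftrightarrow> f \<in> Omega" using full[of f] by (auto simp: U_def)
    then show ?thesis
      using clonoid_membership[OF K k, of f] unfolding basic_classes_def ball_simps by argo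
  qed
  note incl = inclusion_relations[OF KO]
  consider "?c" | "\<not> ?c" "?m" | "\<not> ?c" "?a" | "\<not> ?c" "?r"
    | "\<not> ?c" "\<not> ?m" "\<not> ?a" "\<not> ?r" "\<not> ?l" "\<not> ?g" | "\<not> ?c" "\<not> ?m" "\<not> ?a" "\<not> ?r" "\<not> ?l" "?g"
    | "\<not> ?c" "\<not> ?m" "\<not> ?a" "\<not> ?r" "?l" "\<not> ?g" | "\<not> ?c" "\<not> ?m" "\<not> ?a" "\<not> ?r" "?l" "?g"
    by argo
  then show ?thesis
  proof cases
    case flags: 1
    have red: "f \<in> K \<longleftrightarrow> f \<in> Consts \<and> (?v0 \<longrightarrow> at0 f) \<and> (?v1 \<longrightarrow> at1 f)" for f
      using mem[of f] endpoint_relations[of f] flags incl unfolding class_simps Un_iff by argo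
    have "?v0 \<or> ?v1 \<Longrightarrow> K = Const True"
      "\<not> ?v0 \<and> \<not> ?v1 \<Longrightarrow> K = Consts"
      by (rule set_eqI, rename_tac f, cut_tac f = f in red, cut_tac f = f in endpoint_relations,
          unfold class_simps Un_iff, argo)+
    then show ?thesis unfolding insert_iff by argo
  next
    case flags: 2
    have red: "f \<in> K \<longleftrightarrow> f \<in> Mon \<and> (?v1 \<longrightarrow> at1 f)" for f
      using mem[of f] endpoint_relations[of f] flags incl unfolding class_simps Un_iff by argo
    have "?v1 \<Longrightarrow> K = val1 Mon True"
      "\<not> ?v1 \<Longrightarrow> K = Mon"
      by (rule set_eqI, simp add: red class_simps)+
    then show ?thesis unfolding insert_iff by argo
  next
    case flags: 3
    have red: "f \<in> K \<longleftrightarrow> f \<in> Mon_bar \<and> (?v0 \<longrightarrow> at0 f)" for f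
      using mem[of f] endpoint_relations[of f] flags incl unfolding class_simps Un_iff by argo
    have "?v0 \<Longrightarrow> K = val0 Mon_bar True"
      "\<not> ?v0 \<Longrightarrow> K = Mon_bar"
      by (rule set_eqI, simp add: red class_simps)+
    then show ?thesis unfolding insert_iff by argo
  next
    case flags: 4
    have excl: "\<not> (?t0 \<and> ?f0)" "?v0 \<longrightarrow> ?t0" using flags incl by argo+
    have red: "f \<in> K \<longleftrightarrow> f \<in> Reflexive \<and> (?t0 \<longrightarrow> f \<in> val0 Omega True \<union> Consts) \<and>
        (?f0 \<longrightarrow> f \<in> val0 Omega False \<union> Consts) \<and> (?v0 \<longrightarrow> at0 f)" for f
      using mem[of f] endpoint_relations[of f] flags incl unfolding class_simps Un_iff by argo
    have "?t0 \<and> ?v0 \<and> \<not> ?f0 \<Longrightarrow> K = val01 Reflexive True True"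
      "?t0 \<and> \<not> ?v0 \<and> \<not> ?f0 \<Longrightarrow> K = val01 Reflexive True True \<union> Consts"
      "\<not> ?t0 \<and> \<not> ?v0 \<and> ?f0 \<Longrightarrow> K = val01 Reflexive False False \<union> Consts"
      "\<not> ?t0 \<and> \<not> ?v0 \<and> \<not> ?f0 \<Longrightarrow> K = Reflexive"
      by (rule set_eqI, rename_tac f, cut_tac f = f in red, cut_tac f = f in endpoint_relations,
          unfold class_simps Un_iff, argo)+
    then show ?thesis using excl unfolding insert_iff by argo
  next
    case flags: 5
    have red: "f \<in> K \<longleftrightarrow> f \<in> Omega" for f
      using mem[of f] endpoint_relations[of f] flags incl unfolding class_simps Un_iff by argo
    have "K = Omega" using red by blast
    then show ?thesis unfolding insert_iff by argo
  next
    case flags: 6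
    have excl: "?v0 \<longrightarrow> ?t0" using flags incl by argo+
    have red: "f \<in> K \<longleftrightarrow> f \<in> Omega_ge \<and> (?t0 \<longrightarrow> f \<in> val0 Omega True \<union> Consts) \<and>
        (?f1 \<longrightarrow> f \<in> val1 Omega False \<union> Consts) \<and> (?v0 \<longrightarrow> at0 f)" for f
      using mem[of f] endpoint_relations[of f] flags incl unfolding class_simps Un_iff by argo
    have "\<not> ?t0 \<and> \<not> ?f1 \<and> \<not> ?v0 \<Longrightarrow> K = Omega_ge"
      "?t0 \<and> \<not> ?f1 \<and> \<not> ?v0 \<Longrightarrow> K = val0 Omega True \<union> Consts"
      "?t0 \<and> \<not> ?f1 \<and> ?v0 \<Longrightarrow> K = val0 Omega True"
      "\<not> ?t0 \<and> ?f1 \<and> \<not> ?v0 \<Longrightarrow> K = val1 Omega False \<union> Consts"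
      "?t0 \<and> ?f1 \<and> \<not> ?v0 \<Longrightarrow> K = val01 Omega True False \<union> Consts"
      "?t0 \<and> ?f1 \<and> ?v0 \<Longrightarrow> K = val01 Omega True False \<union> Const True"
      by (rule set_eqI, rename_tac f, cut_tac f = f in red, cut_tac f = f in endpoint_relations,
          unfold class_simps Un_iff, argo)+
    then show ?thesis using excl unfolding insert_iff by argo
  next
    case flags: 7
    have excl: "?v1 \<longrightarrow> ?t1" using flags incl by argo+
    have red: "f \<in> K \<longleftrightarrow> f \<in> Omega_le \<and> (?t1 \<longrightarrow> f \<in> val1 Omega True \<union> Consts) \<and>
        (?f0 \<longrightarrow> f \<in> val0 Omega False \<union> Consts) \<and> (?v1 \<longrightarrow> at1 f)" for f
      using mem[of f] endpoint_relations[of f] flags incl unfolding class_simps Un_iff by argo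
    have "\<not> ?t1 \<and> \<not> ?f0 \<and> \<not> ?v1 \<Longrightarrow> K = Omega_le"
      "?t1 \<and> \<not> ?f0 \<and> \<not> ?v1 \<Longrightarrow> K = val1 Omega True \<union> Consts"
      "?t1 \<and> \<not> ?f0 \<and> ?v1 \<Longrightarrow> K = val1 Omega True"
      "\<not> ?t1 \<and> ?f0 \<and> \<not> ?v1 \<Longrightarrow> K = val0 Omega False \<union> Consts"
      "?t1 \<and> ?f0 \<and> \<not> ?v1 \<Longrightarrow> K = val01 Omega False True \<union> Consts"
      "?t1 \<and> ?f0 \<and> ?v1 \<Longrightarrow> K = val01 Omega False True \<union> Const True"
      by (rule set_eqI, rename_tac f, cut_tac f = f in red, cut_tac f = f in endpoint_relations,
          unfold class_simps Un_iff, argo)+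
    then show ?thesis using excl unfolding insert_iff by argo
  next
    case flags: 8
    have excl: "\<not> (?t0 \<and> ?f0)" "?v0 \<longrightarrow> ?t0" using flags incl by argo+
    have "K \<subseteq> Omega_eq" using flags incl(22) by blast
    then have "?t1 \<longleftrightarrow> ?t0" "?f1 \<longleftrightarrow> ?f0" "?v1 \<longleftrightarrow> ?v0"
      using flags incl(16-21) by blast+
    note flags = flags this
    have red: "f \<in> K \<longleftrightarrow> f \<in> Omega_eq \<and> (?t0 \<longrightarrow> f \<in> val0 Omega True \<union> Consts) \<and>
        (?f0 \<longrightarrow> f \<in> val0 Omega False \<union> Consts) \<and> (?v0 \<longrightarrow> at0 f)" for f
      using mem[of f] endpoint_relations[of f] flags unfolding class_simps Un_iff by argo
    have "\<not> ?t0 \<and> \<not> ?f0 \<and> \<not> ?v0 \<Longrightarrow> K = Omega_eq"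
      "?t0 \<and> \<not> ?f0 \<and> \<not> ?v0 \<Longrightarrow> K = val01 Omega True True \<union> Consts"
      "?t0 \<and> \<not> ?f0 \<and> ?v0 \<Longrightarrow> K = val01 Omega True True"
      "\<not> ?t0 \<and> ?f0 \<and> \<not> ?v0 \<Longrightarrow> K = val01 Omega False False \<union> Consts"
      by (rule set_eqI, rename_tac f, cut_tac f = f in red, cut_tac f = f in endpoint_relations,
          unfold class_simps Un_iff, argo)+
    then show ?thesis using excl unfolding insert_iff by argo
  qed
qed

section \<open>Clonoids without constant 1 functions\<close>

lemma ones_replicate_iff:
  "replicate (arity f) False \<in> ones f \<longleftrightarrow> at0 f" "replicate (arity f) True \<in> ones f \<longleftrightarrow> at1 f"
  by (simp_all add: ones_def at0_def at1_def)

text \<open>Identifying all variables turns a function that is true at both constant tuples into the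
  unary constant 1.\<close>

lemma Const_True_of_endpoints:
  assumes K: "clonoid Proj C K" and g: "g \<in> K" "at0 g" "at1 g"
  shows "K \<inter> Const True \<noteq> {}"
proof -
  let ?h = "reindex 1 (\<lambda>_. 0) g"
  have h: "?h \<in> K" using clonoid_reindex[OF K g(1)] by simp
  have "val ?h a" if a: "a \<in> tuples 1" for a
  proof -
    have "map (\<lambda>i. a ! 0) [0..<arity g] = replicate (arity g) (a ! 0)" by (simp add: map_replicate_const)
    then have "val ?h a = val g (replicate (arity g) (a ! 0))" using a by (simp add: val_reindex)
    then show ?thesis using g(2,3) by (cases "a ! 0") (simp_all add: at0_def at1_def)
  qed
  then have "?h \<in> Const True" using h K by (auto simp: Const_def clonoid_def)
  then show ?thesis using h by blast
qed

text \<open>Members of \<open>U k \<Theta>\<close> inherit three properties from \<open>K\<close>: they are not true at both constant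
  tuples, and if all members of \<open>K\<close> are false at a constant tuple, or everywhere, so are they.  Hence
  \<open>K \<subseteq> Omega_le\<close>, which here means that all members of \<open>K\<close> are false at the zero tuple, is no
  condition on the members of \<open>U k \<Theta>\<close>; the same applies to \<open>Omega_ge\<close> and to the classes of functions
  with least value at a constant tuple.\<close>

lemma clonoid_without_Const_True:
  assumes K: "clonoid Proj (MU01 k) K" and k: "2 \<le> k" and no_one: "K \<inter> Const True = {}"
  shows "(\<exists>\<Theta> \<in> Ideals k. K = U k \<Theta>)
  \<or> (\<exists>\<Theta> \<in> Ideals_in k (val1 Omega True). \<Theta> \<noteq> {} \<and>
       (K = U k \<Theta> \<inter> (val01 Omega False True \<union> Const False) \<or>
        K = U k \<Theta> \<inter> val01 Omega False True))
  \<or> (\<exists>\<Theta> \<in> Ideals_in k (val0 Omega True). \<Theta> \<noteq> {} \<and>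
       (K = U k \<Theta> \<inter> (val01 Omega True False \<union> Const False) \<or>
        K = U k \<Theta> \<inter> val01 Omega True False))
  \<or> (\<exists>\<Theta> \<in> Ideals_in k Mon. \<Theta> \<noteq> {} \<and>
       (K = U k \<Theta> \<inter> val0 Mon False \<or>
        K = U k \<Theta> \<inter> val01 Mon False True))
  \<or> (\<exists>\<Theta> \<in> Ideals_in k Mon_bar. \<Theta> \<noteq> {} \<and>
       (K = U k \<Theta> \<inter> val1 Mon_bar False \<or>
        K = U k \<Theta> \<inter> val01 Mon_bar True False))
  \<or> (\<exists>\<Theta> \<in> Ideals_in k Reflexive. \<Theta> \<noteq> {} \<and>
       K = U k \<Theta> \<inter> val01 Reflexive False False)"
    (is "?all \<or> ?upper1 \<or> ?upper0 \<or> ?mon \<or> ?mon_bar \<or> ?refl")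
proof -
  let ?\<Theta> = "ideal_of k K" and ?U = "U k (ideal_of k K)"
  define N where "N = {f \<in> Omega. \<not> (at0 f \<and> at1 f)}"
  have KO: "K \<subseteq> Omega" using K by (simp add: clonoid_def)
  have one_le_k: "1 \<le> k" using k by simp
  have cover: "\<exists>g \<in> K. arity g = arity f \<and> T \<subseteq> ones g" if "f \<in> ?U" "T \<subseteq> ones f" "card T \<le> k" for f T
    using that mem_U_ideal_of[OF K] by blast
  have U_N: "?U \<subseteq> N"
  proof
    fix f assume f: "f \<in> ?U"
    let ?T = "{replicate (arity f) False, replicate (arity f) True}"
    have "\<not> (at0 f \<and> at1 f)"
    proof
      assume "at0 f \<and> at1 f"
      then have "?T \<subseteq> ones f" by (simp add: ones_replicate_iff)
      moreover have "card ?T \<le> k" using k by (simp add: card_insert_if)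
      ultimately obtain g where g: "g \<in> K" "arity g = arity f" "?T \<subseteq> ones g" using cover[OF f] by blast
      then have "at0 g" "at1 g" by (auto simp flip: ones_replicate_iff)
      then show False using Const_True_of_endpoints[OF K g(1)] no_one by blast
    qed
    then show "f \<in> N" using f by (simp add: U_def N_def)
  qed
  have witness: "\<exists>g \<in> K. arity g = arity f \<and> val g t" if "f \<in> ?U" "t \<in> ones f" for f t
  proof -
    have "card {t} \<le> k" using k by simp
    then show ?thesis using cover[OF that(1), of "{t}"] that(2) by (auto simp: ones_def)
  qed
  have U0: "K \<subseteq> val0 Omega False \<longrightarrow> ?U \<subseteq> val0 Omega False"
  proof (intro impI subsetI)
    fix f assume "K \<subseteq> val0 Omega False" "f \<in> ?U"
    then show "f \<in> val0 Omega False"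
      using witness[of f "replicate (arity f) False"]
      by (fastforce simp: val0_def at0_def ones_def U_def)
  qed
  have U1: "K \<subseteq> val1 Omega False \<longrightarrow> ?U \<subseteq> val1 Omega False"
  proof (intro impI subsetI)
    fix f assume "K \<subseteq> val1 Omega False" "f \<in> ?U"
    then show "f \<in> val1 Omega False"
      using witness[of f "replicate (arity f) True"]
      by (fastforce simp: val1_def at1_def ones_def U_def)
  qed
  have Uc: "K \<subseteq> Const False \<longrightarrow> ?U \<subseteq> Const False"
  proof (intro impI subsetI)
    fix f assume c: "K \<subseteq> Const False" and f: "f \<in> ?U"
    have "\<not> val f t" if t: "t \<in> tuples (arity f)" for t
    proof
      assume "val f t"
      then obtain g where "g \<in> K" "arity g = arity f" "val g t"
        using witness[OF f, of t] t by (auto simp: ones_def)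
      then show False using c t unfolding Const_def by force
    qed
    then show "f \<in> Const False" using f by (simp add: Const_def U_def)
  qed
  \<comment> \<open>\<open>f0\<close>, \<open>f1\<close>: the value at the tuple of zeros (ones) is the least value; \<open>t0\<close>, \<open>t1\<close>: it is
    the greatest value; \<open>v0\<close>, \<open>v1\<close>: it is 1.\<close>
  let ?l = "K \<subseteq> Omega_le" and ?g = "K \<subseteq> Omega_ge"
    and ?f0 = "K \<subseteq> val0 Omega False \<union> Consts" and ?f1 = "K \<subseteq> val1 Omega False \<union> Consts"
    and ?t0 = "K \<subseteq> val0 Omega True \<union> Consts" and ?t1 = "K \<subseteq> val1 Omega True \<union> Consts"
    and ?v0 = "K \<subseteq> val0 Omega True" and ?v1 = "K \<subseteq> val1 Omega True"
    and ?m = "K \<subseteq> Mon" and ?a = "K \<subseteq> Mon_bar" and ?r = "K \<subseteq> Reflexive" and ?c = "K \<subseteq> Consts"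
    and ?z0 = "K \<subseteq> val0 Omega False" and ?z1 = "K \<subseteq> val1 Omega False" and ?zc = "K \<subseteq> Const False"
  have mem: "(f \<in> K \<longleftrightarrow> f \<in> ?U \<and> (?l \<longrightarrow> f \<in> Omega_le) \<and> (?g \<longrightarrow> f \<in> Omega_ge) \<and>
      (?f0 \<longrightarrow> f \<in> val0 Omega False \<union> Consts) \<and> (?f1 \<longrightarrow> f \<in> val1 Omega False \<union> Consts) \<and>
      (?t0 \<longrightarrow> f \<in> val0 Omega True \<union> Consts) \<and> (?t1 \<longrightarrow> f \<in> val1 Omega True \<union> Consts) \<and>
      (?v0 \<longrightarrow> f \<in> val0 Omega True) \<and> (?v1 \<longrightarrow> f \<in> val1 Omega True) \<and>
      (?m \<longrightarrow> f \<in> Mon) \<and> (?a \<longrightarrow> f \<in> Mon_bar) \<and> (?r \<longrightarrow> f \<in> Reflexive) \<and> (?c \<longrightarrow> f \<in> Consts)) \<and>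
      (f \<in> ?U \<longrightarrow> f \<in> Omega \<and> \<not> (at0 f \<and> at1 f) \<and> (?z0 \<longrightarrow> \<not> at0 f) \<and> (?z1 \<longrightarrow> \<not> at1 f) \<and>
        (?zc \<longrightarrow> f \<in> Const False))"
    for f
  proof -
    have "f \<in> ?U \<longrightarrow> f \<in> Omega \<and> \<not> (at0 f \<and> at1 f)" using U_N by (auto simp: N_def)
    moreover have "f \<in> ?U \<and> ?z0 \<longrightarrow> \<not> at0 f" using U0 by (auto simp: val0_def)
    moreover have "f \<in> ?U \<and> ?z1 \<longrightarrow> \<not> at1 f" using U1 by (auto simp: val1_def)
    moreover have "f \<in> ?U \<and> ?zc \<longrightarrow> f \<in> Const False" using Uc by blast
    ultimately show ?thesis
      using clonoid_membership[OF K one_le_k, of f] unfolding basic_classes_def ball_simps by argo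
  qed
  have KN: "K \<subseteq> N" using clonoid_subset_U[OF K] U_N by blast
  have incl_N: "?l \<and> K \<subseteq> N \<longrightarrow> ?z0" "?f0 \<and> K \<subseteq> N \<longrightarrow> ?z0" "?m \<and> K \<subseteq> N \<longrightarrow> ?z0" "?r \<and> K \<subseteq> N \<longrightarrow> ?z0"
    "?g \<and> K \<subseteq> N \<longrightarrow> ?z1" "?f1 \<and> K \<subseteq> N \<longrightarrow> ?z1" "?a \<and> K \<subseteq> N \<longrightarrow> ?z1" "?r \<and> K \<subseteq> N \<longrightarrow> ?z1"
    "?c \<and> K \<subseteq> N \<longrightarrow> ?zc" "?t1 \<and> ?z1 \<longrightarrow> ?c" "?t0 \<and> ?z0 \<longrightarrow> ?c"
    by (rule subset_by_members, rename_tac f, cut_tac f = f in endpoint_relations,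
        unfold class_simps Un_iff N_def mem_Collect_eq, argo)+
  then have "?l \<longrightarrow> ?z0" "?f0 \<longrightarrow> ?z0" "?m \<longrightarrow> ?z0" "?r \<longrightarrow> ?z0" "?g \<longrightarrow> ?z1" "?f1 \<longrightarrow> ?z1"
    "?a \<longrightarrow> ?z1" "?r \<longrightarrow> ?z1" "?c \<longrightarrow> ?zc" "?t1 \<and> ?z1 \<longrightarrow> ?c" "?t0 \<and> ?z0 \<longrightarrow> ?c"
    using KN by argo+
  note incl = this inclusion_relations[OF KO]
  have Const_case: "K = ?U" if "?c"
  proof -
    have "f \<in> K" if f: "f \<in> ?U" for f
    proof -
      obtain g where "g \<in> K" using cover[OF f, of "{}"] by auto
      then have "g \<in> Const False" using \<open>?c\<close> incl(9) by blast
      then have "\<not> ?v0" "\<not> ?v1" using \<open>g \<in> K\<close> Const_facts(1)[of g] unfolding subset_iff class_simps by blast+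
      then show ?thesis
        using \<open>?c\<close> f mem[of f] endpoint_relations[of f] incl(9) unfolding class_simps Un_iff by argo
    qed
    then show ?thesis using clonoid_subset_U[OF K] by blast
  qed
  have Mon_case: "K = ?U \<inter> val0 Mon False \<or> K = ?U \<inter> val01 Mon False True" if flags: "\<not> ?c" "?m"
  proof -
    have red: "f \<in> K \<longleftrightarrow> f \<in> ?U \<and> f \<in> Mon \<and> \<not> at0 f \<and> (?v1 \<longrightarrow> at1 f)" for f
      using mem[of f] endpoint_relations[of f] flags incl unfolding class_simps Un_iff by argo
    have U_Omega: "f \<in> ?U \<longrightarrow> f \<in> Omega" for f by (simp add: U_def)
    have "?v1 \<Longrightarrow> K = ?U \<inter> val01 Mon False True"
      "\<not> ?v1 \<Longrightarrow> K = ?U \<inter> val0 Mon False"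
      by (rule set_eqI, rename_tac f, cut_tac f = f in red, cut_tac f = f in endpoint_relations,
          cut_tac f = f in U_Omega, unfold class_simps Un_iff Int_iff, argo)+
    then show ?thesis by argo
  qed
  have Mon_bar_case: "K = ?U \<inter> val1 Mon_bar False \<or> K = ?U \<inter> val01 Mon_bar True False" if flags: "\<not> ?c" "?a"
  proof -
    have red: "f \<in> K \<longleftrightarrow> f \<in> ?U \<and> f \<in> Mon_bar \<and> \<not> at1 f \<and> (?v0 \<longrightarrow> at0 f)" for f
      using mem[of f] endpoint_relations[of f] flags incl unfolding class_simps Un_iff by argo
    have U_Omega: "f \<in> ?U \<longrightarrow> f \<in> Omega" for f by (simp add: U_def)
    have "?v0 \<Longrightarrow> K = ?U \<inter> val01 Mon_bar True False"
      "\<not> ?v0 \<Longrightarrow> K = ?U \<inter> val1 Mon_bar False"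
      by (rule set_eqI, rename_tac f, cut_tac f = f in red, cut_tac f = f in endpoint_relations,
          cut_tac f = f in U_Omega, unfold class_simps Un_iff Int_iff, argo)+
    then show ?thesis by argo
  qed
  have Reflexive_case: "K = ?U \<inter> val01 Reflexive False False" if flags: "\<not> ?c" "?r"
  proof -
    have red: "f \<in> K \<longleftrightarrow> f \<in> ?U \<and> f \<in> Reflexive \<and> \<not> at0 f" for f
      using mem[of f] endpoint_relations[of f] flags incl unfolding class_simps Un_iff by argo
    have U_Omega: "f \<in> ?U \<longrightarrow> f \<in> Omega" for f by (simp add: U_def)
    have "K = ?U \<inter> val01 Reflexive False False"
      by (rule set_eqI, rename_tac f, cut_tac f = f in red, cut_tac f = f in endpoint_relations,
          cut_tac f = f in U_Omega, unfold class_simps Un_iff Int_iff, argo)+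
    then show ?thesis by argo
  qed
  have t1_case: "K = ?U \<inter> (val01 Omega False True \<union> Const False) \<or> K = ?U \<inter> val01 Omega False True"
    if flags: "\<not> ?c" "\<not> ?m" "\<not> ?a" "\<not> ?r" "?t1"
  proof -
    have red: "f \<in> K \<longleftrightarrow> f \<in> ?U \<and> (\<not> at1 f \<longrightarrow> f \<in> Const False) \<and> \<not> (at0 f \<and> at1 f) \<and>
        (?v1 \<longrightarrow> at1 f)" for f
      using mem[of f] endpoint_relations[of f] flags incl unfolding class_simps Un_iff by argo
    have U_Omega: "f \<in> ?U \<longrightarrow> f \<in> Omega" for f by (simp add: U_def)
    have "?v1 \<Longrightarrow> K = ?U \<inter> val01 Omega False True"
      "\<not> ?v1 \<Longrightarrow> K = ?U \<inter> (val01 Omega False True \<union> Const False)"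
      by (rule set_eqI, rename_tac f, cut_tac f = f in red, cut_tac f = f in endpoint_relations,
          cut_tac f = f in U_Omega, unfold class_simps Un_iff Int_iff, argo)+
    then show ?thesis by argo
  qed
  have t0_case: "K = ?U \<inter> (val01 Omega True False \<union> Const False) \<or> K = ?U \<inter> val01 Omega True False"
    if flags: "\<not> ?c" "\<not> ?m" "\<not> ?a" "\<not> ?r" "?t0"
  proof -
    have red: "f \<in> K \<longleftrightarrow> f \<in> ?U \<and> (\<not> at0 f \<longrightarrow> f \<in> Const False) \<and> \<not> (at0 f \<and> at1 f) \<and>
        (?v0 \<longrightarrow> at0 f)" for f
      using mem[of f] endpoint_relations[of f] flags incl unfolding class_simps Un_iff by argo
    have U_Omega: "f \<in> ?U \<longrightarrow> f \<in> Omega" for f by (simp add: U_def)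
    have "?v0 \<Longrightarrow> K = ?U \<inter> val01 Omega True False"
      "\<not> ?v0 \<Longrightarrow> K = ?U \<inter> (val01 Omega True False \<union> Const False)"
      by (rule set_eqI, rename_tac f, cut_tac f = f in red, cut_tac f = f in endpoint_relations,
          cut_tac f = f in U_Omega, unfold class_simps Un_iff Int_iff, argo)+
    then show ?thesis by argo
  qed
  have rest_case: "K = ?U" if flags: "\<not> ?c" "\<not> ?m" "\<not> ?a" "\<not> ?r" "\<not> ?t0" "\<not> ?t1"
  proof -
    have red: "f \<in> K \<longleftrightarrow> f \<in> ?U" for f
      using mem[of f] endpoint_relations[of f] flags incl unfolding class_simps Un_iff by argo
    then show ?thesis by blast
  qed
  have sub: "?\<Theta> \<in> Ideals_in k D" if "K \<subseteq> D" for D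
    using ideal_of_Ideals_in[OF K, of D k] that KO minorant_refl by blast
  \<comment> \<open>A constant 0 is below a minor in one variable of any other member.\<close>
  have majorant: "\<exists>h \<in> K \<inter> D. minorant g h"
    if "g \<in> K" and D: "K \<subseteq> D \<union> Const False" "\<not> K \<subseteq> Const False" and
      "\<And>n h. h \<in> K \<inter> D \<Longrightarrow> 1 \<le> n \<Longrightarrow> reindex n (\<lambda>_. 0) h \<in> D" for g D
  proof (cases "g \<in> D")
    case True
    then show ?thesis using that KO minorant_refl by blast
  next
    case False
    then have g: "g \<in> Const False" using that by blast
    obtain h where h: "h \<in> K \<inter> D" using D by blast
    let ?h = "reindex (arity g) (\<lambda>_. 0) h"
    have "g \<in> Omega" using that KO by blast
    then have "1 \<le> arity g" by (rule arity_pos)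
    then have "?h \<in> K" "?h \<in> D" using clonoid_reindex[OF K, of h] h that by auto
    moreover have "minorant g ?h"
      using g \<open>?h \<in> K\<close> KO \<open>g \<in> Omega\<close> by (auto simp: minorant_def Const_def)
    ultimately show ?thesis by blast
  qed
  have id1: "?\<Theta> \<in> Ideals_in k (val1 Omega True)" if "?t1" "\<not> ?c"
  proof (rule ideal_of_Ideals_in[OF K majorant])
    show "K \<subseteq> val1 Omega True \<union> Const False" using that(1) no_one by (auto simp: Consts_def)
    show "\<not> K \<subseteq> Const False" using that(2) by (auto simp: Consts_def)
  qed (use KO reindex_in_Omega in \<open>auto simp: val1_def at_reindex\<close>)
  have id0: "?\<Theta> \<in> Ideals_in k (val0 Omega True)" if "?t0" "\<not> ?c"
  proof (rule ideal_of_Ideals_in[OF K majorant])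
    show "K \<subseteq> val0 Omega True \<union> Const False" using that(1) no_one by (auto simp: Consts_def)
    show "\<not> K \<subseteq> Const False" using that(2) by (auto simp: Consts_def)
  qed (use KO reindex_in_Omega in \<open>auto simp: val0_def at_reindex\<close>)
  have ne: "?\<Theta> \<noteq> {}" if nonconst: "\<not> ?c"
  proof -
    obtain g where g: "g \<in> K" using nonconst by blast
    have gO: "g \<in> Omega" using g KO by blast
    have "minorant (chi (arity g) {}) g" using minorant_chi_iff[OF gO, of "{}"] by simp
    moreover have "chi (arity g) {} \<in> Omega_upto k"
      using arity_pos[OF gO] by (simp add: Omega_upto_def ones_chi) (simp add: chi_def)
    ultimately show ?thesis using g unfolding ideal_of_def majorized_def by blast
  qed
  have U_case: "\<exists>\<Theta> \<in> Ideals k. K = U k \<Theta>" if "K = ?U"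
    using that ideal_of_Ideals[OF K] by blast
  consider "?c" | "\<not> ?c" "?m" | "\<not> ?c" "?a" | "\<not> ?c" "?r" | "\<not> ?c" "\<not> ?m" "\<not> ?a" "\<not> ?r" "?t1"
    | "\<not> ?c" "\<not> ?m" "\<not> ?a" "\<not> ?r" "?t0" | "\<not> ?c" "\<not> ?m" "\<not> ?a" "\<not> ?r" "\<not> ?t0" "\<not> ?t1"
    by argo
  then show ?thesis
  proof cases
    case 1 then show ?thesis using U_case[OF Const_case] by (intro disjI1)
  next
    case 2
    have ?mon by (intro bexI conjI, rule ne[OF 2(1)], rule Mon_case[OF 2], rule sub[OF 2(2)])
    then show ?thesis by argo
  next
    case 3
    have ?mon_bar by (intro bexI conjI, rule ne[OF 3(1)], rule Mon_bar_case[OF 3], rule sub[OF 3(2)])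
    then show ?thesis by argo
  next
    case 4
    have ?refl by (intro bexI conjI, rule ne[OF 4(1)], rule Reflexive_case[OF 4], rule sub[OF 4(2)])
    then show ?thesis by argo
  next
    case 5
    have ?upper1 by (intro bexI conjI, rule ne[OF 5(1)], rule t1_case[OF 5], rule id1[OF 5(5,1)])
    then show ?thesis by argo
  next
    case 6
    have ?upper0 by (intro bexI conjI, rule ne[OF 6(1)], rule t0_case[OF 6], rule id0[OF 6(5,1)])
    then show ?thesis by argo
  next
    case 7 then show ?thesis using U_case[OF rest_case] by (intro disjI1)
  qed
qed

section \<open>The classification\<close>

lemma class_intersections:
  "Omega_eq = Omega_le \<inter> Omega_ge"
  "val01 X a b = val0 X a \<inter> val1 X b"
  "val01 Omega a b \<union> Consts = (val0 Omega a \<union> Consts) \<inter> (val1 Omega b \<union> Consts)"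
  "val0 Mon a = Mon \<inter> val0 Omega a" "val1 Mon b = Mon \<inter> val1 Omega b"
  "val0 Mon_bar a = Mon_bar \<inter> val0 Omega a" "val1 Mon_bar b = Mon_bar \<inter> val1 Omega b"
  "val0 Reflexive a = Reflexive \<inter> val0 Omega a" "val1 Reflexive b = Reflexive \<inter> val1 Omega b"
  "val01 Reflexive a b \<union> Consts = Reflexive \<inter> ((val0 Omega a \<union> Consts) \<inter> (val1 Omega b \<union> Consts))"
  by (rule set_eqI, rename_tac f, cut_tac f = f in endpoint_relations,
      unfold class_simps Un_iff Int_iff, argo)+

lemma Consts_facts: "f \<in> Consts \<Longrightarrow> f \<in> Omega \<and> (at0 f \<longleftrightarrow> at1 f)"
  using endpoint_relations[of f] unfolding class_simps by blast

text \<open>A constant function takes the same value at both constant tuples, so intersecting with a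
  class given by a value selects one of the two constants.\<close>

lemma class_intersections_Const:
  "Const a = Consts \<inter> val0 Omega a"
  "val01 Omega a (\<not> a) \<union> Const a = val0 Omega a \<inter> (val1 Omega (\<not> a) \<union> Consts)"
  "val01 Omega a (\<not> a) \<union> Const (\<not> a) = val1 Omega (\<not> a) \<inter> (val0 Omega a \<union> Consts)"
proof -
  show Const: "Const a = Consts \<inter> val0 Omega a" for a
    by (cases a) (auto simp: class_simps dest: Const_facts)
  show "val01 Omega a (\<not> a) \<union> Const a = val0 Omega a \<inter> (val1 Omega (\<not> a) \<union> Consts)"
    "val01 Omega a (\<not> a) \<union> Const (\<not> a) = val1 Omega (\<not> a) \<inter> (val0 Omega a \<union> Consts)"
    unfolding Const by (auto simp: class_simps(4-6) dest: Consts_facts)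
qed

lemma listed_classes_are_clonoids:
  fixes k :: nat
  defines "cl \<equiv> clonoid Proj (MU01 k)"
  shows "cl (val0 Omega a)" "cl (val1 Omega b)" "cl Omega_le" "cl Omega_ge" "cl Omega_eq"
    "cl (val0 Omega a \<union> Consts)" "cl (val1 Omega b \<union> Consts)"
    "cl (val01 Omega a b)" "cl (val01 Omega a b \<union> Consts)"
    "cl (val01 Omega False True \<union> Const b)" "cl (val01 Omega True False \<union> Const b)"
    "cl Mon" "cl (val0 Mon a)" "cl (val1 Mon b)" "cl (val01 Mon a b)"
    "cl Mon_bar" "cl (val0 Mon_bar a)" "cl (val1 Mon_bar b)" "cl (val01 Mon_bar a b)"
    "cl Reflexive" "cl (val01 Reflexive a b)" "cl (val01 Reflexive a b \<union> Consts)"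
    "cl Consts" "cl (Const a)"
proof -
  note Int = clonoid_Int[of Proj "MU01 k", folded cl_def]
  have basic: "cl B" if "B \<in> basic_classes" for B
    using clonoid_basic[OF that] by (simp add: cl_def)
  show V0: "cl (val0 Omega a)" and V1: "cl (val1 Omega b)" for a b
    by (simp_all add: cl_def clonoid_val0 clonoid_val1)
  show le: "cl Omega_le" and ge: "cl Omega_ge" and M: "cl Mon" and N: "cl Mon_bar"
    and R: "cl Reflexive" and C: "cl Consts"
    by (rule basic, simp add: basic_classes_def)+
  show C0: "cl (val0 Omega a \<union> Consts)" and C1: "cl (val1 Omega b \<union> Consts)" for a b
    by (rule basic, cases a, simp_all add: basic_classes_def)
      (rule basic, cases b, simp_all add: basic_classes_def)
  show "cl Omega_eq" unfolding class_intersections(1) by (intro Int le ge)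
  show "cl (val01 Omega a b)" unfolding class_intersections(2) by (intro Int V0 V1)
  show "cl (val01 Omega a b \<union> Consts)" unfolding class_intersections(3) by (intro Int C0 C1)
  show M0: "cl (val0 Mon a)" and M1: "cl (val1 Mon b)" for a b
    unfolding class_intersections(4,5) by (intro Int M V0 V1)+
  show N0: "cl (val0 Mon_bar a)" and N1: "cl (val1 Mon_bar b)" for a b
    unfolding class_intersections(6,7) by (intro Int N V0 V1)+
  show "cl (val01 Mon a b)" "cl (val01 Mon_bar a b)"
    unfolding class_intersections(2) by (intro Int M0 M1 N0 N1)+
  show "cl (val01 Reflexive a b)"
    unfolding class_intersections(2,8,9) by (intro Int R V0 V1)
  show "cl (val01 Reflexive a b \<union> Consts)"
    unfolding class_intersections(10) by (intro Int R C0 C1)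
  show "cl (Const a)"
    unfolding class_intersections_Const(1) by (intro Int C V0)
  have "cl (val01 Omega d (\<not> d) \<union> Const d)" "cl (val01 Omega d (\<not> d) \<union> Const (\<not> d))" for d
    unfolding class_intersections_Const(2,3) by (intro Int V0 V1 C0 C1)+
  from this[of False] this[of True]
  show "cl (val01 Omega False True \<union> Const b)" "cl (val01 Omega True False \<union> Const b)"
    by (cases b; simp)+
qed

theorem theorem6p1p1:
  fixes k :: nat and K :: "boolfun set"
  assumes "k \<ge> 2" and "K \<subseteq> Omega"
  shows "clonoid Proj (MU01 k) K \<longleftrightarrow>
    (\<exists>\<Theta> \<in> Ideals k. K = U k \<Theta>)
  \<or> (\<exists>\<Theta> \<in> Ideals_in k (val1 Omega True). \<Theta> \<noteq> {} \<and>
       (K = U k \<Theta> \<inter> (val01 Omega False True \<union> Const False) \<or>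
        K = U k \<Theta> \<inter> val01 Omega False True))
  \<or> (\<exists>\<Theta> \<in> Ideals_in k (val0 Omega True). \<Theta> \<noteq> {} \<and>
       (K = U k \<Theta> \<inter> (val01 Omega True False \<union> Const False) \<or>
        K = U k \<Theta> \<inter> val01 Omega True False))
  \<or> (\<exists>\<Theta> \<in> Ideals_in k Mon. \<Theta> \<noteq> {} \<and>
       (K = U k \<Theta> \<inter> val0 Mon False \<or>
        K = U k \<Theta> \<inter> val01 Mon False True))
  \<or> (\<exists>\<Theta> \<in> Ideals_in k Mon_bar. \<Theta> \<noteq> {} \<and>
       (K = U k \<Theta> \<inter> val1 Mon_bar False \<or>
        K = U k \<Theta> \<inter> val01 Mon_bar True False))
  \<or> (\<exists>\<Theta> \<in> Ideals_in k Reflexive. \<Theta> \<noteq> {} \<and>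
       K = U k \<Theta> \<inter> val01 Reflexive False False)
  \<or> K \<in> {Omega_le, Omega_ge, Omega_eq,
         val0 Omega False \<union> Consts, val1 Omega False \<union> Consts,
         val0 Omega True \<union> Consts, val1 Omega True \<union> Consts,
         val01 Omega False False \<union> Consts, val01 Omega False True \<union> Consts,
         val01 Omega True False \<union> Consts, val01 Omega True True \<union> Consts,
         val01 Omega False True \<union> Const True, val01 Omega True False \<union> Const True,
         val0 Omega True, val1 Omega True, val01 Omega True True,
         Mon, val1 Mon True, Mon_bar, val0 Mon_bar True,
         Reflexive, val01 Reflexive False False \<union> Consts, val01 Reflexive True True \<union> Consts,
         val01 Reflexive True True,
         Consts, Const True}"
    (is "_ \<longleftrightarrow> ?ideal \<or> ?b \<or> ?c \<or> ?d \<or> ?e \<or> ?f \<or> K \<in> ?finite")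
proof
  assume K: "clonoid Proj (MU01 k) K"
  show "?ideal \<or> ?b \<or> ?c \<or> ?d \<or> ?e \<or> ?f \<or> K \<in> ?finite"
  proof (cases "K \<inter> Const True = {}")
    case True
    then show ?thesis using clonoid_without_Const_True[OF K assms(1)] by argo
  next
    case False
    have "1 \<le> k" using assms(1) by simp
    then have "K \<in> insert Omega ?finite" by (rule clonoid_with_Const_True[OF K _ False])
    then show ?thesis
    proof (rule insertE)
      assume "K = Omega"
      moreover have "U k (ideal_of k K) \<subseteq> Omega" by (auto simp: U_def)
      ultimately have "K = U k (ideal_of k K)" using clonoid_subset_U[OF K, of k] by blast
      then have ?ideal using ideal_of_Ideals[OF K] by blast
      then show ?thesis by (rule disjI1)
    next
      assume "K \<in> ?finite"
      then show ?thesis by (intro disjI2)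
    qed
  qed
next
  note closed = listed_classes_are_clonoids[of k]
  note closed_U = clonoid_Int[OF clonoid_U]
  assume "?ideal \<or> ?b \<or> ?c \<or> ?d \<or> ?e \<or> ?f \<or> K \<in> ?finite"
  moreover have "clonoid Proj (MU01 k) K" if "K \<in> ?finite"
    using that unfolding insert_iff empty_iff
    by (elim disjE FalseE) (erule ssubst, rule closed)+
  moreover have "clonoid Proj (MU01 k) (U k \<Theta>)" for \<Theta>
    by (rule clonoid_U)
  moreover have "clonoid Proj (MU01 k) (U k \<Theta> \<inter> X)"
    if "X \<in> {val01 Omega False True \<union> Const False, val01 Omega False True,
      val01 Omega True False \<union> Const False, val01 Omega True False, val0 Mon False,
      val01 Mon False True, val1 Mon_bar False, val01 Mon_bar True False,
      val01 Reflexive False False}" for \<Theta> X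
    using that unfolding insert_iff empty_iff
    by (intro closed_U, elim disjE FalseE) (erule ssubst, rule closed)+
  ultimately show "clonoid Proj (MU01 k) K"
    by (elim disjE bexE conjE) (simp_all only: insert_iff simp_thms)
qed

end
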